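(* Let $X\subset Y$ be metric spaces and let $\mathcal{B}$ be a class of Banach spaces. Put $K_{\mathcal{B}}:=\sup\{\nu(E,E^{\ast\ast}) : E\in\mathcal{B}\}$, where $E$ is regarded as a subset of its bidual $E^{\ast\ast}$ via the canonical embedding. Then $$\nu_{\mathcal{B}}(X,Y)\le K_{\mathcal{B}}\cdot \sup_{F}\lambda_{\mathrm{Lip}}(F,Y),$$ where the supremum is taken over all finite subsets $F\subset X$. Moreover, if $\mathrm{Lip}_0(X)^\ast$ is contained in $\mathcal{B}$, then $$\lambda_{\mathrm{Lip}}(X,Y)\le \nu_{\mathcal{B}}(X,Y).$$ As a consequence, for every metric space $Y$, $$\lambda_{\mathrm{Lip}}(Y)=\nu_{\mathrm{dual}}(Y)=\nu_{\mathrm{fin}}(Y).$$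
   Context: All Banach spaces are real; subsets of metric spaces carry the induced metric. For a Lipschitz map $f$, $\mathrm{Lip}(f):=\inf\{L\ge 0: f \text{ is } L\text{-Lipschitz}\}$. Given metric spaces $X\subset Y$, a Banach space $E$ and a Lipschitz map $f\colon X\to E$, let $e(X,Y,E,f)$ be the infimum of those $K\ge 0$ for which there is a $K\,\mathrm{Lip}(f)$-Lipschitz map $\bar f\colon Y\to E$ with $\bar f|_X=f$ (infimum of the empty set is $\infty$). Define $\nu(X,Y):=\sup\{e(X,Y,E,f): E \text{ a Banach space},\ f\colon X\to E \text{ Lipschitz}\}$. For a class $\mathcal{B}$ of Banach spaces put $\nu_{\mathcal{B}}(X,Y):=\sup\{e(X,Y,E,f): E\in\mathcal{B},\ f\colon X\to E\text{ Lipschitz}\}$ and $\nu_{\mathcal{B}}(Y):=\sup_{X\subset Y}\nu_{\mathcal{B}}(X,Y)$. Let $\nu_{\mathrm{fin}}(Y):=\nu_{\mathcal{B}_{\mathrm{fin}}}(Y)$ and $\nu_{\mathrm{dual}}(Y):=\nu_{\mathcal{B}_{\mathrm{dual}}}(Y)$, where $\mathcal{B}_{\mathrm{fin}}$ is the class of all finite-dimensional Banach spaces and $\mathcal{B}_{\mathrm{dual}}$ is the class of all dual Banach spaces. For a pointed metric space $(X,p)$, $\mathrm{Lip}_0(X)$ is the Banach space of all Lipschitz functions $f\colon X\to\mathbb{R}$ with $f(p)=0$, with norm $|f|_{\mathrm{Lip}}=\sup_{x\ne x'}|f(x)-f(x')|/d(x,x')$. For $X\subset Y$ (with a common basepoint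 $p\in X$; the choice is immaterial) a linear extension operator for $X\subset Y$ is a bounded linear map $T\colon \mathrm{Lip}_0(X)\to\mathrm{Lip}_0(Y)$ with $(Tf)|_X=f$ for all $f\in\mathrm{Lip}_0(X)$. Define $\lambda_{\mathrm{Lip}}(X,Y):=\inf\{\|T\|: T\text{ is a linear extension operator for }X\subset Y\}$ and $\lambda_{\mathrm{Lip}}(Y):=\sup\{\lambda_{\mathrm{Lip}}(X,Y): X\subset Y\}$. Subsets are understood to be non-empty. *)

theory Defs
  imports "HOL-Analysis.Analysis" "HOL-Library.Function_Algebras"
begin

section \<open>Functions as a real vector space\<close>

instantiation "fun" :: (type, real_vector) real_vector
begin

definition scaleR_fun_def: "c *\<^sub>R f = (\<lambda>x. c *\<^sub>R f x)"

instance
  by standard (simp_all add: scaleR_fun_def fun_eq_iff scaleR_add_right scaleR_add_left)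

end

lemma scaleR_fun_apply [simp]: "(c *\<^sub>R f) x = c *\<^sub>R f x"
  by (simp add: scaleR_fun_def)


section \<open>Normed spaces as objects\<close>

text \<open>Classes of Banach spaces and suprema over them require Banach spaces to be values rather than
  types. A normed space is given by a linear subspace of some real vector space type together with a
  norm on that subspace (the values of the norm elsewhere are irrelevant). The ambient type only
  supplies the vector space operations; it carries no topology.\<close>

record 'v nvs =
  vecs :: "'v set"
  nrm :: "'v \<Rightarrow> real"

definition normed_space :: "'v::real_vector nvs \<Rightarrow> bool" where
  "normed_space E \<longleftrightarrow> subspace (vecs E) \<and>
     (\<forall>x\<in>vecs E. 0 \<le> nrm E x \<and> (nrm E x = 0 \<longleftrightarrow> x = 0)) \<and>
     (\<forall>c. \<forall>x\<in>vecs E. nrm E (c *\<^sub>R x) = \<bar>c\<bar> * nrm E x) \<and>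
     (\<forall>x\<in>vecs E. \<forall>y\<in>vecs E. nrm E (x + y) \<le> nrm E x + nrm E y)"

text \<open>The case distinction is needed because the axioms of \<^locale>\<open>Metric_space\<close> require
  nonnegativity and symmetry of the distance also off the carrier.\<close>

definition norm_metric :: "'v::real_vector nvs \<Rightarrow> 'v metric" where
  "norm_metric E =
     metric (vecs E, \<lambda>x y. if x \<in> vecs E \<and> y \<in> vecs E then nrm E (x - y) else 0)"

lemma Metric_space_norm_metric:
  assumes "normed_space E"
  shows "Metric_space (vecs E) (\<lambda>x y. if x \<in> vecs E \<and> y \<in> vecs E then nrm E (x - y) else 0)"
proof -
  have sub: "subspace (vecs E)"
    and nonneg: "\<And>x. x \<in> vecs E \<Longrightarrow> 0 \<le> nrm E x"
    and zero: "\<And>x. x \<in> vecs E \<Longrightarrow> nrm E x = 0 \<longleftrightarrow> x = 0"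
    and scale: "\<And>c x. x \<in> vecs E \<Longrightarrow> nrm E (c *\<^sub>R x) = \<bar>c\<bar> * nrm E x"
    and triangle: "\<And>x y. x \<in> vecs E \<Longrightarrow> y \<in> vecs E \<Longrightarrow> nrm E (x + y) \<le> nrm E x + nrm E y"
    using assms unfolding normed_space_def by blast+
  have diff: "x - y \<in> vecs E" if "x \<in> vecs E" "y \<in> vecs E" for x y
    using sub that by (rule subspace_diff)
  have commute: "nrm E (x - y) = nrm E (y - x)" if "x \<in> vecs E" "y \<in> vecs E" for x y
    using scale[OF diff[OF that(2,1)], of "-1"] by simp
  have triangle_diff: "nrm E (x - z) \<le> nrm E (x - y) + nrm E (y - z)"
    if "x \<in> vecs E" "y \<in> vecs E" "z \<in> vecs E" for x y z
    using triangle[OF diff[OF that(1,2)] diff[OF that(2,3)]] by simp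
  show ?thesis
    by (rule Metric_space.intro)
      (simp_all add: nonneg diff zero commute triangle_diff)
qed

lemma mspace_norm_metric [simp]: "normed_space E \<Longrightarrow> mspace (norm_metric E) = vecs E"
  unfolding norm_metric_def by (rule Metric_space.mspace_metric[OF Metric_space_norm_metric])

lemma mdist_norm_metric:
  "\<lbrakk>normed_space E; x \<in> vecs E; y \<in> vecs E\<rbrakk> \<Longrightarrow> mdist (norm_metric E) x y = nrm E (x - y)"
  unfolding norm_metric_def by (simp add: Metric_space.mdist_metric[OF Metric_space_norm_metric])

definition banach_space :: "'v::real_vector nvs \<Rightarrow> bool" where
  "banach_space E \<longleftrightarrow> normed_space E \<and> mcomplete_of (norm_metric E)"

definition finite_dimensional :: "'v::real_vector nvs \<Rightarrow> bool" where
  "finite_dimensional E \<longleftrightarrow> (\<exists>S. finite S \<and> vecs E = span S)"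

definition linear_map :: "'v::real_vector nvs \<Rightarrow> 'w::real_vector nvs \<Rightarrow> ('v \<Rightarrow> 'w) \<Rightarrow> bool" where
  "linear_map E F T \<longleftrightarrow> T \<in> vecs E \<rightarrow> vecs F \<and>
     (\<forall>x\<in>vecs E. \<forall>y\<in>vecs E. T (x + y) = T x + T y) \<and>
     (\<forall>c. \<forall>x\<in>vecs E. T (c *\<^sub>R x) = c *\<^sub>R T x)"

definition bounded_linear_map :: "'v::real_vector nvs \<Rightarrow> 'w::real_vector nvs \<Rightarrow> ('v \<Rightarrow> 'w) \<Rightarrow> bool"
  where "bounded_linear_map E F T \<longleftrightarrow>
     linear_map E F T \<and> (\<exists>K. \<forall>x\<in>vecs E. nrm F (T x) \<le> K * nrm E x)"

definition op_norm :: "'v::real_vector nvs \<Rightarrow> 'w::real_vector nvs \<Rightarrow> ('v \<Rightarrow> 'w) \<Rightarrow> real" where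
  "op_norm E F T = (SUP x\<in>{x \<in> vecs E. nrm E x \<le> 1}. nrm F (T x))"

definition isometrically_isomorphic :: "'v::real_vector nvs \<Rightarrow> 'w::real_vector nvs \<Rightarrow> bool" where
  "isometrically_isomorphic E F \<longleftrightarrow>
     (\<exists>T. linear_map E F T \<and> bij_betw T (vecs E) (vecs F) \<and> (\<forall>x\<in>vecs E. nrm F (T x) = nrm E x))"


section \<open>Duals and the canonical embedding\<close>

definition real_line :: "real nvs" where
  "real_line = \<lparr>vecs = UNIV, nrm = abs\<rparr>"

text \<open>A function on the carrier of a space is represented by its extension by zero to the whole type.\<close>

definition dual_of :: "'v::real_vector nvs \<Rightarrow> ('v \<Rightarrow> real) nvs" where
  "dual_of E = \<lparr>vecs = {\<phi>. bounded_linear_map E real_line \<phi> \<and> (\<forall>x. x \<notin> vecs E \<longrightarrow> \<phi> x = 0)},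
                nrm = op_norm E real_line\<rparr>"

definition bidual_embedding :: "'v::real_vector nvs \<Rightarrow> 'v \<Rightarrow> ('v \<Rightarrow> real) \<Rightarrow> real" where
  "bidual_embedding E x = (\<lambda>\<phi>. if \<phi> \<in> vecs (dual_of E) then \<phi> x else 0)"

text \<open>Every predual \<open>Z\<close> of \<open>E\<close> embeds isometrically into its bidual, a copy of the dual of \<open>E\<close>, whose
  elements have type \<open>'v \<Rightarrow> real\<close>. So nothing is lost by seeking preduals in that type.\<close>

definition dual_banach_space :: "'v::real_vector nvs \<Rightarrow> bool" where
  "dual_banach_space E \<longleftrightarrow> banach_space E \<and>
     (\<exists>Z :: ('v \<Rightarrow> real) nvs. banach_space Z \<and> isometrically_isomorphic (dual_of Z) E)"


section \<open>Lipschitz extension constants\<close>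

definition lipschitz_map :: "real \<Rightarrow> 'a metric \<Rightarrow> 'b metric \<Rightarrow> ('a \<Rightarrow> 'b) \<Rightarrow> bool" where
  "lipschitz_map L m1 m2 f \<longleftrightarrow> f \<in> mspace m1 \<rightarrow> mspace m2 \<and>
     (\<forall>x\<in>mspace m1. \<forall>y\<in>mspace m1. mdist m2 (f x) (f y) \<le> L * mdist m1 x y)"

definition Lip :: "'a metric \<Rightarrow> 'b metric \<Rightarrow> ('a \<Rightarrow> 'b) \<Rightarrow> real" where
  "Lip m1 m2 f = Inf {L. 0 \<le> L \<and> lipschitz_map L m1 m2 f}"

definition ext_const :: "'a set \<Rightarrow> 'a metric \<Rightarrow> 'v::real_vector nvs \<Rightarrow> ('a \<Rightarrow> 'v) \<Rightarrow> ennreal" where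
  "ext_const X Y E f = Inf {ennreal K | K. 0 \<le> K \<and>
     (\<exists>g. lipschitz_map (K * Lip (submetric Y X) (norm_metric E) f) Y (norm_metric E) g \<and>
          (\<forall>x\<in>X. g x = f x))}"

definition nu_class :: "'v::real_vector nvs set \<Rightarrow> 'a set \<Rightarrow> 'a metric \<Rightarrow> ennreal" where
  "nu_class \<B> X Y =
     (SUP E\<in>\<B>. SUP f\<in>{f. Lipschitz_continuous_map (submetric Y X) (norm_metric E) f}.
        ext_const X Y E f)"

definition nu_class_all :: "'v::real_vector nvs set \<Rightarrow> 'a metric \<Rightarrow> ennreal" where
  "nu_class_all \<B> Y = (SUP X\<in>{X. X \<noteq> {} \<and> X \<subseteq> mspace Y}. nu_class \<B> X Y)"

text \<open>The universe for "all Banach spaces", relative to metric spaces over \<open>'a\<close>. The first factor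
  contains the dual of \<open>Lip\<^sub>0(X)\<close>, hence the Lipschitz-free space of \<open>X\<close>; since every Lipschitz map
  from \<open>X\<close> to a Banach space factors linearly, with the same Lipschitz constant, through the free
  space, the supremum defining \<open>\<nu>(X,Y)\<close> is already attained there. It also contains a copy of every
  finite-dimensional space. The second factor is an arbitrary real vector space type, so that
  statements polymorphic in \<open>'u\<close> cover Banach spaces of any size.\<close>

type_synonym ('a, 'u) banach_universe = "(('a \<Rightarrow> real) \<Rightarrow> real) \<times> 'u"

definition nu :: "'u::real_vector itself \<Rightarrow> 'a set \<Rightarrow> 'a metric \<Rightarrow> ennreal" where
  "nu _ X Y = nu_class {E :: ('a, 'u) banach_universe nvs. banach_space E} X Y"

definition nu_fin :: "'u::real_vector itself \<Rightarrow> 'a metric \<Rightarrow> ennreal" where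
  "nu_fin _ Y =
     nu_class_all {E :: ('a, 'u) banach_universe nvs. banach_space E \<and> finite_dimensional E} Y"

definition nu_dual :: "'u::real_vector itself \<Rightarrow> 'a metric \<Rightarrow> ennreal" where
  "nu_dual _ Y = nu_class_all {E :: ('a, 'u) banach_universe nvs. dual_banach_space E} Y"

definition K_const :: "'u::real_vector itself \<Rightarrow> 'v::real_vector nvs set \<Rightarrow> ennreal" where
  "K_const U \<B> =
     (SUP E\<in>\<B>. nu U (bidual_embedding E ` vecs E) (norm_metric (dual_of (dual_of E))))"


section \<open>Linear extension operators\<close>

text \<open>The element 0 is inserted so that the norm is 0 if \<open>X\<close> is a single point.\<close>

definition Lip0 :: "'a \<Rightarrow> 'a metric \<Rightarrow> ('a \<Rightarrow> real) nvs" where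
  "Lip0 p X =
     \<lparr>vecs = {f. Lipschitz_continuous_map X euclidean_metric f \<and> f p = 0 \<and>
                  (\<forall>x. x \<notin> mspace X \<longrightarrow> f x = 0)},
      nrm = (\<lambda>f. Sup (insert 0
        {\<bar>f x - f x'\<bar> / mdist X x x' | x x'. x \<in> mspace X \<and> x' \<in> mspace X \<and> x \<noteq> x'}))\<rparr>"

definition linear_ext_op ::
    "'a \<Rightarrow> 'a set \<Rightarrow> 'a metric \<Rightarrow> (('a \<Rightarrow> real) \<Rightarrow> ('a \<Rightarrow> real)) \<Rightarrow> bool" where
  "linear_ext_op p X Y T \<longleftrightarrow> bounded_linear_map (Lip0 p (submetric Y X)) (Lip0 p Y) T \<and>
     (\<forall>f\<in>vecs (Lip0 p (submetric Y X)). \<forall>x\<in>X. T f x = f x)"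

definition lambda_Lip :: "'a set \<Rightarrow> 'a metric \<Rightarrow> ennreal" where
  "lambda_Lip X Y = (let p = (SOME p. p \<in> X) in
     Inf {ennreal (op_norm (Lip0 p (submetric Y X)) (Lip0 p Y) T) | T. linear_ext_op p X Y T})"

definition lambda_Lip_all :: "'a metric \<Rightarrow> ennreal" where
  "lambda_Lip_all Y = (SUP X\<in>{X. X \<noteq> {} \<and> X \<subseteq> mspace Y}. lambda_Lip X Y)"

end

theory Submission
  imports Defs
begin

text \<open>Let \<open>X \<subseteq> Y\<close>. A Lipschitz map \<open>f\<close> from \<open>X\<close> to a dual space \<open>Z\<^sup>*\<close> is the family of real Lipschitz
  functions \<open>x \<mapsto> \<langle>f(x), z\<rangle>\<close>, which depends linearly on \<open>z \<in> Z\<close>. A linear extension operator for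
  \<open>X \<subseteq> Y\<close> extends all members at once and keeps the linear dependence, so it extends \<open>f\<close> to a map
  from \<open>Y\<close> to \<open>Z\<^sup>*\<close>, with the norm of the operator as the constant (\<open>extend_into_dual\<close>). Hence
  \<open>\<nu>\<^bsub>dual\<^esub>(Y) \<le> \<lambda>\<^bsub>Lip\<^esub>(Y)\<close>. For an arbitrary Banach space \<open>E\<close>, the same procedure extends \<open>f\<close> as a map
  into the bidual, and an extension of the identity of \<open>E\<close> to a map \<open>E\<^sup>*\<^sup>* \<rightarrow> E\<close> brings the result back
  to \<open>E\<close> at the cost of a factor \<open>\<nu>(E, E\<^sup>*\<^sup>*)\<close> (\<open>ext_const_le_K_const_mult_lambda_Lip\<close>). That \<open>E\<close>
  embeds isometrically into its bidual is the Hahn--Banach theorem, proved here by way of minimal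
  sublinear functions.

  Conversely, any Lipschitz extension to \<open>Y\<close> of the evaluation map \<open>X \<rightarrow> Lip\<^sub>0(X)\<^sup>*\<close> defines a linear
  extension operator whose norm is at most the constant of the extension
  (\<open>lambda_Lip_le_nu_class\<close>). As \<open>Lip\<^sub>0(X)\<^sup>*\<close> is a dual space, and finite-dimensional if \<open>X\<close> is
  finite, this bounds \<open>\<lambda>\<^bsub>Lip\<^esub>(X, Y)\<close> by \<open>\<nu>\<^bsub>dual\<^esub>(Y)\<close>, and by \<open>\<nu>\<^bsub>fin\<^esub>(Y)\<close> if \<open>X\<close> is finite.

  The passage from finite subsets to \<open>X\<close> is a compactness argument: linear extension operators of
  norm at most \<open>c\<close> for all finite subsets of \<open>X\<close> accumulate, pointwise, at one for \<open>X\<close>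
  (\<open>lambda_Lip_le_SUP_finite\<close>). Since finite-dimensional spaces are dual spaces
  (\<open>dual_banach_space_if_finite_dimensional\<close>), this closes the circle
  \<open>\<lambda>\<^bsub>Lip\<^esub>(Y) \<le> \<nu>\<^bsub>fin\<^esub>(Y) \<le> \<nu>\<^bsub>dual\<^esub>(Y) \<le> \<lambda>\<^bsub>Lip\<^esub>(Y)\<close>.\<close>


section \<open>Normed spaces and their operators\<close>

lemma
  assumes "normed_space E"
  shows normed_space_subspace: "subspace (vecs E)"
    and nrm_nonneg: "x \<in> vecs E \<Longrightarrow> 0 \<le> nrm E x"
    and nrm_eq_0_iff: "x \<in> vecs E \<Longrightarrow> nrm E x = 0 \<longleftrightarrow> x = 0"
    and nrm_scaleR: "x \<in> vecs E \<Longrightarrow> nrm E (c *\<^sub>R x) = \<bar>c\<bar> * nrm E x"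
    and nrm_triangle: "x \<in> vecs E \<Longrightarrow> y \<in> vecs E \<Longrightarrow> nrm E (x + y) \<le> nrm E x + nrm E y"
  using assms unfolding normed_space_def by blast+

lemma
  assumes "normed_space E"
  shows vecs_0: "0 \<in> vecs E"
    and vecs_add: "x \<in> vecs E \<Longrightarrow> y \<in> vecs E \<Longrightarrow> x + y \<in> vecs E"
    and vecs_scaleR: "x \<in> vecs E \<Longrightarrow> c *\<^sub>R x \<in> vecs E"
    and vecs_diff: "x \<in> vecs E \<Longrightarrow> y \<in> vecs E \<Longrightarrow> x - y \<in> vecs E"
  using normed_space_subspace[OF assms]
  by (simp_all add: subspace_0 subspace_add subspace_scale subspace_diff)

lemma nrm_0: "normed_space E \<Longrightarrow> nrm E 0 = 0"
  using nrm_eq_0_iff vecs_0 by blast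

lemma normed_space_if_banach_space: "banach_space E \<Longrightarrow> normed_space E"
  by (simp add: banach_space_def)

lemma banach_space_iff_Cauchy_convergent:
  "banach_space E \<longleftrightarrow> normed_space E \<and>
     (\<forall>\<sigma> :: nat \<Rightarrow> 'v::real_vector. range \<sigma> \<subseteq> vecs E \<and> (\<forall>\<epsilon>>0. \<exists>N. \<forall>m n. N \<le> m \<longrightarrow> N \<le> n \<longrightarrow> nrm E (\<sigma> m - \<sigma> n) < \<epsilon>) \<longrightarrow>
        (\<exists>l\<in>vecs E. \<forall>\<epsilon>>0. \<exists>N. \<forall>n\<ge>N. nrm E (\<sigma> n - l) < \<epsilon>))"
proof (cases "normed_space E")
  case True
  interpret M: Metric_space "mspace (norm_metric E)" "mdist (norm_metric E)"
    by simp
  have "M.MCauchy \<sigma> \<longleftrightarrow>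
      range \<sigma> \<subseteq> vecs E \<and> (\<forall>\<epsilon>>0. \<exists>N. \<forall>m n. N \<le> m \<longrightarrow> N \<le> n \<longrightarrow> nrm E (\<sigma> m - \<sigma> n) < \<epsilon>)" for \<sigma>
    unfolding M.MCauchy_def using True
    by (auto simp: mdist_norm_metric range_subsetD cong: conj_cong)
  moreover have "limitin M.mtopology \<sigma> l sequentially \<longleftrightarrow>
      l \<in> vecs E \<and> (\<forall>\<epsilon>>0. \<exists>N. \<forall>n\<ge>N. nrm E (\<sigma> n - l) < \<epsilon>)" if "range \<sigma> \<subseteq> vecs E" for \<sigma> l
    unfolding M.limit_metric_sequentially using that True
    by (auto simp: mdist_norm_metric range_subsetD cong: conj_cong)
  ultimately show ?thesis
    unfolding banach_space_def mcomplete_of_def M.mcomplete_def using True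
    by (simp add: Bex_def)
qed (simp add: banach_space_def)

text \<open>Boundedness of point evaluations makes a norm-Cauchy sequence converge pointwise; closedness of
  the balls under pointwise limits then makes the pointwise limit a limit in norm. Both spaces of
  functions that occur below, duals and \<open>Lip\<^sub>0\<close>, are of this kind.\<close>

lemma banach_space_of_functions:
  fixes E :: "('b \<Rightarrow> real) nvs"
  assumes E: "normed_space E"
    and eval: "\<And>x. \<exists>C. \<forall>f\<in>vecs E. \<bar>f x\<bar> \<le> C * nrm E f"
    and closed: "\<And>f l c. \<lbrakk>\<And>n::nat. f n \<in> vecs E; \<And>n. nrm E (f n) \<le> c; \<And>x. (\<lambda>n. f n x) \<longlonglongrightarrow> l x\<rbrakk>
      \<Longrightarrow> l \<in> vecs E \<and> nrm E l \<le> c"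
  shows "banach_space E"
  unfolding banach_space_iff_Cauchy_convergent
proof (intro conjI E allI impI, elim conjE)
  fix f :: "nat \<Rightarrow> 'b \<Rightarrow> real"
  assume "range f \<subseteq> vecs E"
    and Cauchy: "\<forall>\<epsilon>>0. \<exists>N. \<forall>m n. N \<le> m \<longrightarrow> N \<le> n \<longrightarrow> nrm E (f m - f n) < \<epsilon>"
  then have f: "f n \<in> vecs E" for n
    by auto
  have "Cauchy (\<lambda>n. f n x)" for x
  proof (rule metric_CauchyI)
    fix e :: real assume "e > 0"
    obtain C where C: "\<bar>g x\<bar> \<le> C * nrm E g" if "g \<in> vecs E" for g
      using eval by blast
    obtain N where N: "N \<le> m \<Longrightarrow> N \<le> n \<Longrightarrow> nrm E (f m - f n) < e / (\<bar>C\<bar> + 1)" for m n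
      using Cauchy[rule_format, of "e / (\<bar>C\<bar> + 1)"] \<open>e > 0\<close> by auto
    have "dist (f m x) (f n x) < e" if "N \<le> m" "N \<le> n" for m n
    proof -
      have "\<bar>f m x - f n x\<bar> \<le> C * nrm E (f m - f n)"
        using C[OF vecs_diff[OF E f f], of m n] by simp
      also have "\<dots> \<le> (\<bar>C\<bar> + 1) * nrm E (f m - f n)"
        by (intro mult_right_mono nrm_nonneg[OF E] vecs_diff[OF E] f) simp
      also have "\<dots> < e"
        using N[OF that] by (simp add: field_simps)
      finally show ?thesis
        by (simp add: dist_real_def)
    qed
    then show "\<exists>N. \<forall>m\<ge>N. \<forall>n\<ge>N. dist (f m x) (f n x) < e"
      by blast
  qed
  then obtain l where l: "(\<lambda>n. f n x) \<longlonglongrightarrow> l x" for x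
    unfolding Cauchy_convergent_iff convergent_def by metis
  have tail: "f N - l \<in> vecs E \<and> nrm E (f N - l) \<le> e"
    if "\<And>n. N \<le> n \<Longrightarrow> nrm E (f N - f n) \<le> e" for N e
  proof (rule closed)
    show "f N - f (n + N) \<in> vecs E" "nrm E (f N - f (n + N)) \<le> e" for n
      using that by (auto intro!: vecs_diff[OF E] f)
    show "(\<lambda>n. (f N - f (n + N)) x) \<longlonglongrightarrow> (f N - l) x" for x
      unfolding fun_diff_def by (intro tendsto_intros LIMSEQ_ignore_initial_segment l)
  qed
  have conv: "\<exists>N. \<forall>n\<ge>N. f n - l \<in> vecs E \<and> nrm E (f n - l) < e" if "e > 0" for e
  proof -
    obtain N where N: "N \<le> m \<Longrightarrow> N \<le> n \<Longrightarrow> nrm E (f m - f n) < e / 2" for m n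
      using Cauchy[rule_format, of "e / 2"] \<open>e > 0\<close> by auto
    have "f n - l \<in> vecs E \<and> nrm E (f n - l) \<le> e / 2" if "n \<ge> N" for n
      by (rule tail) (rule less_imp_le[OF N], use that in simp_all)
    with \<open>e > 0\<close> show ?thesis
      by (intro exI[of _ N]) fastforce
  qed
  obtain N where "f N - l \<in> vecs E"
    using conv[of 1] by auto
  then have "l \<in> vecs E"
    using vecs_diff[OF E f[of N]] by fastforce
  with conv show "\<exists>l\<in>vecs E. \<forall>\<epsilon>>0. \<exists>N. \<forall>n\<ge>N. nrm E (f n - l) < \<epsilon>"
    by blast
qed

lemma
  assumes "linear_map E F T"
  shows linear_map_in: "x \<in> vecs E \<Longrightarrow> T x \<in> vecs F"
    and linear_map_add: "x \<in> vecs E \<Longrightarrow> y \<in> vecs E \<Longrightarrow> T (x + y) = T x + T y"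
    and linear_map_scaleR: "x \<in> vecs E \<Longrightarrow> T (c *\<^sub>R x) = c *\<^sub>R T x"
  using assms by (auto simp: linear_map_def)

lemma linear_map_0: "\<lbrakk>linear_map E F T; normed_space E\<rbrakk> \<Longrightarrow> T 0 = 0"
  using linear_map_scaleR[of E F T 0 0] vecs_0[of E] by simp

lemma linear_map_diff:
  assumes "linear_map E F T" "normed_space E" "x \<in> vecs E" "y \<in> vecs E"
  shows "T (x - y) = T x - T y"
  using linear_map_add[OF assms(1,3) vecs_scaleR[OF assms(2,4)], of "-1"]
    linear_map_scaleR[OF assms(1,4), of "-1"] by simp

lemma op_norm_bdd_above:
  assumes "bounded_linear_map E F T" and E: "normed_space E" and F: "normed_space F"
  shows "bdd_above ((\<lambda>x. nrm F (T x)) ` {x \<in> vecs E. nrm E x \<le> 1})"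
proof -
  obtain K where K: "nrm F (T x) \<le> K * nrm E x" if "x \<in> vecs E" for x
    using assms(1) by (auto simp: bounded_linear_map_def)
  have "nrm F (T x) \<le> \<bar>K\<bar>" if "x \<in> vecs E" "nrm E x \<le> 1" for x
  proof -
    have "K * nrm E x \<le> \<bar>K\<bar> * 1"
      using that nrm_nonneg[OF E] by (intro mult_mono) auto
    then show ?thesis
      using K[OF that(1)] by simp
  qed
  then show ?thesis
    by (auto simp: bdd_above_def)
qed

lemma op_norm_nonneg:
  assumes "bounded_linear_map E F T" and E: "normed_space E" and F: "normed_space F"
  shows "0 \<le> op_norm E F T"
proof -
  have lin: "linear_map E F T"
    using assms(1) by (simp add: bounded_linear_map_def)
  have "nrm F (T 0) \<le> op_norm E F T"
    unfolding op_norm_def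
    by (rule cSUP_upper[OF _ op_norm_bdd_above[OF assms]]) (simp add: vecs_0[OF E] nrm_0[OF E])
  then show ?thesis
    by (simp add: linear_map_0[OF lin E] nrm_0[OF F])
qed

lemma nrm_le_op_norm:
  assumes T: "bounded_linear_map E F T" and E: "normed_space E" and F: "normed_space F"
    and x: "x \<in> vecs E"
  shows "nrm F (T x) \<le> op_norm E F T * nrm E x"
proof (cases "x = 0")
  case True
  then show ?thesis
    using T linear_map_0[OF _ E, of F T] nrm_0[OF E] nrm_0[OF F] by (simp add: bounded_linear_map_def)
next
  case False
  then have pos: "nrm E x > 0"
    using nrm_nonneg[OF E x] nrm_eq_0_iff[OF E x] by simp
  have lin: "linear_map E F T"
    using T by (simp add: bounded_linear_map_def)
  have "nrm F (T ((1 / nrm E x) *\<^sub>R x)) \<le> op_norm E F T"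
    unfolding op_norm_def
    by (rule cSUP_upper[OF _ op_norm_bdd_above[OF T E F]])
      (use pos x in \<open>simp add: vecs_scaleR[OF E] nrm_scaleR[OF E]\<close>)
  then show ?thesis
    using pos
    by (simp add: linear_map_scaleR[OF lin x] nrm_scaleR[OF F linear_map_in[OF lin x]] field_simps)
qed

lemma op_norm_le:
  assumes E: "normed_space E" and "0 \<le> c" and "\<And>x. x \<in> vecs E \<Longrightarrow> nrm F (T x) \<le> c * nrm E x"
  shows "op_norm E F T \<le> c"
  unfolding op_norm_def
proof (rule cSUP_least)
  show "{x \<in> vecs E. nrm E x \<le> 1} \<noteq> {}"
    using vecs_0[OF E] nrm_0[OF E] by force
  fix x assume "x \<in> {x \<in> vecs E. nrm E x \<le> 1}"
  then show "nrm F (T x) \<le> c"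
    using assms(3)[of x] mult_left_mono[OF _ \<open>0 \<le> c\<close>, of "nrm E x" 1] by simp
qed


section \<open>Dual spaces\<close>

lemma normed_space_real_line: "normed_space real_line"
  by (auto simp: normed_space_def real_line_def abs_mult)

lemma nrm_real_line [simp]: "nrm real_line r = \<bar>r\<bar>"
  and vecs_real_line [simp]: "vecs real_line = UNIV"
  by (simp_all add: real_line_def)

lemma vecs_dual_of_iff:
  "\<phi> \<in> vecs (dual_of E) \<longleftrightarrow>
     (\<forall>x\<in>vecs E. \<forall>y\<in>vecs E. \<phi> (x + y) = \<phi> x + \<phi> y) \<and>
     (\<forall>c. \<forall>x\<in>vecs E. \<phi> (c *\<^sub>R x) = c * \<phi> x) \<and>
     (\<exists>K. \<forall>x\<in>vecs E. \<bar>\<phi> x\<bar> \<le> K * nrm E x) \<and> (\<forall>x. x \<notin> vecs E \<longrightarrow> \<phi> x = 0)"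
  by (simp add: dual_of_def bounded_linear_map_def linear_map_def)

lemma dual_ofI:
  assumes "\<And>x y. \<lbrakk>x \<in> vecs E; y \<in> vecs E\<rbrakk> \<Longrightarrow> \<phi> (x + y) = \<phi> x + \<phi> y"
    and "\<And>c x. x \<in> vecs E \<Longrightarrow> \<phi> (c *\<^sub>R x) = c * \<phi> x"
    and "\<And>x. x \<in> vecs E \<Longrightarrow> \<bar>\<phi> x\<bar> \<le> K * nrm E x"
    and "\<And>x. x \<notin> vecs E \<Longrightarrow> \<phi> x = 0"
  shows "\<phi> \<in> vecs (dual_of E)"
  unfolding vecs_dual_of_iff using assms by blast

lemma bounded_linear_map_if_dual: "\<phi> \<in> vecs (dual_of E) \<Longrightarrow> bounded_linear_map E real_line \<phi>"
  by (simp add: dual_of_def)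

lemma
  assumes "\<phi> \<in> vecs (dual_of E)"
  shows dual_add: "x \<in> vecs E \<Longrightarrow> y \<in> vecs E \<Longrightarrow> \<phi> (x + y) = \<phi> x + \<phi> y"
    and dual_scaleR: "x \<in> vecs E \<Longrightarrow> \<phi> (c *\<^sub>R x) = c * \<phi> x"
    and dual_outside: "x \<notin> vecs E \<Longrightarrow> \<phi> x = 0"
  using assms by (auto simp: vecs_dual_of_iff)

lemma dual_diff:
  assumes "\<phi> \<in> vecs (dual_of E)" "normed_space E" "x \<in> vecs E" "y \<in> vecs E"
  shows "\<phi> (x - y) = \<phi> x - \<phi> y"
  using bounded_linear_map_if_dual[OF assms(1)] linear_map_diff[OF _ assms(2-4)]
  by (auto simp: bounded_linear_map_def)

lemma dual_0:
  assumes "\<phi> \<in> vecs (dual_of E)" "normed_space E"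
  shows "\<phi> 0 = 0"
  using dual_diff[OF assms vecs_0[OF assms(2)] vecs_0[OF assms(2)]] by simp

lemma abs_dual_le:
  assumes "normed_space E" "\<phi> \<in> vecs (dual_of E)" "x \<in> vecs E"
  shows "\<bar>\<phi> x\<bar> \<le> nrm (dual_of E) \<phi> * nrm E x"
  using nrm_le_op_norm[OF bounded_linear_map_if_dual[OF assms(2)] assms(1) normed_space_real_line assms(3)]
  by (simp add: dual_of_def)

lemma nrm_dual_nonneg:
  assumes "normed_space E" "\<phi> \<in> vecs (dual_of E)"
  shows "0 \<le> nrm (dual_of E) \<phi>"
  using op_norm_nonneg[OF bounded_linear_map_if_dual[OF assms(2)] assms(1) normed_space_real_line]
  by (simp add: dual_of_def)

lemma nrm_dual_le:
  assumes "normed_space E" "0 \<le> c" "\<And>x. x \<in> vecs E \<Longrightarrow> \<bar>\<phi> x\<bar> \<le> c * nrm E x"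
  shows "nrm (dual_of E) \<phi> \<le> c"
  using op_norm_le[of E c real_line \<phi>] assms by (simp add: dual_of_def)

lemma normed_space_dual_of:
  assumes E: "normed_space E"
  shows "normed_space (dual_of E)"
proof -
  let ?D = "dual_of E"
  have add: "\<phi> + \<psi> \<in> vecs ?D \<and> nrm ?D (\<phi> + \<psi>) \<le> nrm ?D \<phi> + nrm ?D \<psi>"
    if "\<phi> \<in> vecs ?D" "\<psi> \<in> vecs ?D" for \<phi> \<psi>
  proof -
    have bound: "\<bar>(\<phi> + \<psi>) x\<bar> \<le> (nrm ?D \<phi> + nrm ?D \<psi>) * nrm E x" if "x \<in> vecs E" for x
      using abs_dual_le[OF E \<open>\<phi> \<in> _\<close> that] abs_dual_le[OF E \<open>\<psi> \<in> _\<close> that]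
      by (simp add: algebra_simps)
    have "\<phi> + \<psi> \<in> vecs ?D"
      by (rule dual_ofI[OF _ _ bound])
        (use that in \<open>simp_all add: dual_add dual_scaleR dual_outside algebra_simps\<close>)
    moreover have "nrm ?D (\<phi> + \<psi>) \<le> nrm ?D \<phi> + nrm ?D \<psi>"
      using bound that by (intro nrm_dual_le[OF E]) (auto intro!: add_nonneg_nonneg nrm_dual_nonneg[OF E])
    ultimately show ?thesis ..
  qed
  have scale_le: "c *\<^sub>R \<phi> \<in> vecs ?D \<and> nrm ?D (c *\<^sub>R \<phi>) \<le> \<bar>c\<bar> * nrm ?D \<phi>" if "\<phi> \<in> vecs ?D" for c \<phi>
  proof -
    have bound: "\<bar>(c *\<^sub>R \<phi>) x\<bar> \<le> (\<bar>c\<bar> * nrm ?D \<phi>) * nrm E x" if "x \<in> vecs E" for x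
      using abs_dual_le[OF E \<open>\<phi> \<in> _\<close> that]
      by (simp add: abs_mult mult.assoc mult_left_mono)
    have "c *\<^sub>R \<phi> \<in> vecs ?D"
      by (rule dual_ofI[OF _ _ bound])
        (use that in \<open>simp_all add: dual_add dual_scaleR dual_outside algebra_simps\<close>)
    moreover have "nrm ?D (c *\<^sub>R \<phi>) \<le> \<bar>c\<bar> * nrm ?D \<phi>"
      using bound that by (intro nrm_dual_le[OF E]) (auto intro!: mult_nonneg_nonneg nrm_dual_nonneg[OF E])
    ultimately show ?thesis ..
  qed
  have zero: "0 \<in> vecs ?D"
    by (auto simp: vecs_dual_of_iff intro: exI[of _ 0])
  have scale: "nrm ?D (c *\<^sub>R \<phi>) = \<bar>c\<bar> * nrm ?D \<phi>" if "\<phi> \<in> vecs ?D" for c \<phi>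
  proof (cases "c = 0")
    case True
    then show ?thesis
      using scale_le[OF that, of 0] nrm_dual_nonneg[OF E zero] by simp
  next
    case False
    then have "nrm ?D \<phi> \<le> \<bar>1 / c\<bar> * nrm ?D (c *\<^sub>R \<phi>)"
      using scale_le[of "c *\<^sub>R \<phi>" "1 / c"] scale_le[OF that, of c] by simp
    with False show ?thesis
      using scale_le[OF that, of c] by (simp add: field_simps)
  qed
  have "nrm ?D \<phi> = 0 \<longleftrightarrow> \<phi> = 0" if "\<phi> \<in> vecs ?D" for \<phi>
  proof
    assume "nrm ?D \<phi> = 0"
    then have "\<phi> x = 0" for x
      using abs_dual_le[OF E that, of x] dual_outside[OF that, of x] by (cases "x \<in> vecs E") auto
    then show "\<phi> = 0"
      by auto
  next
    assume "\<phi> = 0"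
    then show "nrm ?D \<phi> = 0"
      using scale[OF that, of 0] by simp
  qed
  then show ?thesis
    unfolding normed_space_def subspace_def
    using add scale scale_le zero nrm_dual_nonneg[OF E] by auto
qed

lemma banach_space_dual_of:
  assumes E: "normed_space E"
  shows "banach_space (dual_of E)"
proof (rule banach_space_of_functions[OF normed_space_dual_of[OF E]])
  show "\<exists>C. \<forall>\<phi>\<in>vecs (dual_of E). \<bar>\<phi> x\<bar> \<le> C * nrm (dual_of E) \<phi>" for x
  proof (cases "x \<in> vecs E")
    case True
    then show ?thesis
      using abs_dual_le[OF E _ True] by (intro exI[of _ "nrm E x"]) (simp add: mult.commute)
  next
    case False
    then show ?thesis
      by (intro exI[of _ 0]) (simp add: dual_outside)
  qed
next
  fix f :: "nat \<Rightarrow> 'a \<Rightarrow> real" and l c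
  assume f: "f n \<in> vecs (dual_of E)" and c: "nrm (dual_of E) (f n) \<le> c"
    and l: "(\<lambda>n. f n x) \<longlonglongrightarrow> l x" for n x
  have "0 \<le> c"
    using nrm_dual_nonneg[OF E f[of 0]] c[of 0] by simp
  have bound: "\<bar>l x\<bar> \<le> c * nrm E x" if "x \<in> vecs E" for x
  proof (rule LIMSEQ_le_const2[OF tendsto_rabs[OF l]])
    have "\<bar>f n x\<bar> \<le> c * nrm E x" for n
      using abs_dual_le[OF E f that] mult_right_mono[OF c nrm_nonneg[OF E that]] by (rule order_trans)
    then show "\<exists>N. \<forall>n\<ge>N. \<bar>f n x\<bar> \<le> c * nrm E x"
      by blast
  qed
  have "l (x + y) = l x + l y" if "x \<in> vecs E" "y \<in> vecs E" for x y
    using LIMSEQ_unique[OF l[of "x + y"]] tendsto_add[OF l[of x] l[of y]] that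
    by (simp add: dual_add[OF f])
  moreover have "l (a *\<^sub>R x) = a * l x" if "x \<in> vecs E" for a x
    using LIMSEQ_unique[OF l[of "a *\<^sub>R x"]] tendsto_mult_left[OF l[of x], of a] that
    by (simp add: dual_scaleR[OF f])
  moreover have "l x = 0" if "x \<notin> vecs E" for x
    using LIMSEQ_unique[OF l[of x]] that by (simp add: dual_outside[OF f])
  ultimately show "l \<in> vecs (dual_of E) \<and> nrm (dual_of E) l \<le> c"
    using dual_ofI[OF _ _ bound] nrm_dual_le[OF E \<open>0 \<le> c\<close> bound] by blast
qed


section \<open>The Hahn--Banach theorem\<close>

definition sublinear :: "('v::real_vector \<Rightarrow> real) \<Rightarrow> bool" where
  "sublinear p \<longleftrightarrow> (\<forall>x y. p (x + y) \<le> p x + p y) \<and> (\<forall>c\<ge>0. \<forall>x. p (c *\<^sub>R x) = c * p x)"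

lemma
  assumes "sublinear p"
  shows sublinear_add: "p (x + y) \<le> p x + p y"
    and sublinear_scaleR: "0 \<le> c \<Longrightarrow> p (c *\<^sub>R x) = c * p x"
    and sublinear_0: "p 0 = 0"
    and sublinear_minus: "- p (- x) \<le> p x"
proof -
  show add: "p (x + y) \<le> p x + p y" and scale: "0 \<le> c \<Longrightarrow> p (c *\<^sub>R x) = c * p x" for c x y
    using assms by (auto simp: sublinear_def)
  show zero: "p 0 = 0"
    using scale[of 0 0] by simp
  show "- p (- x) \<le> p x"
    using add[of x "- x"] zero by simp
qed

lemma sublinearI:
  assumes add: "\<And>x y. p (x + y) \<le> p x + p y"
    and le: "\<And>c x. 0 < c \<Longrightarrow> p (c *\<^sub>R x) \<le> c * p x"
    and zero: "p 0 = 0"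
  shows "sublinear p"
  unfolding sublinear_def
proof (intro conjI allI impI add)
  fix c :: real and x
  assume "0 \<le> c"
  show "p (c *\<^sub>R x) = c * p x"
  proof (cases "c = 0")
    case False
    with \<open>0 \<le> c\<close> have "0 < c"
      by simp
    then have "p x \<le> (1 / c) * p (c *\<^sub>R x)"
      using le[of "1 / c" "c *\<^sub>R x"] by simp
    with le[OF \<open>0 < c\<close>, of x] show ?thesis
      using \<open>0 < c\<close> by (simp add: field_simps)
  qed (simp add: zero)
qed

text \<open>Every sublinear \<open>q \<le> p\<close> with \<open>q(-z) \<le> -p(z)\<close> satisfies
  \<open>q(x) \<le> q(x + tz) + t q(-z) \<le> p(x + tz) - t p(z)\<close> for all \<open>t \<ge> 0\<close>. The infimum over \<open>t\<close> of the last
  expression is the largest such function.\<close>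

lemma sublinear_flatten:
  assumes p: "sublinear p"
  obtains q where "sublinear q" "q \<le> p" "q (- z) \<le> - p z"
proof -
  define q where "q x = (INF t\<in>{0..}. p (x + t *\<^sub>R z) - t * p z)" for x
  have "- p (- x) \<le> p (x + t *\<^sub>R z) - t * p z" if "0 \<le> t" for x t
    using sublinear_add[OF p, of "x + t *\<^sub>R z" "- x"] sublinear_scaleR[OF p that, of z] by simp
  then have bdd: "bdd_below ((\<lambda>t. p (x + t *\<^sub>R z) - t * p z) ` {0..})" for x
    by (intro bdd_belowI2[of _ "- p (- x)"]) auto
  have le: "q x \<le> p (x + t *\<^sub>R z) - t * p z" if "0 \<le> t" for x t
    unfolding q_def using that by (intro cINF_lower[OF bdd]) simp
  have greatest: "a \<le> q x" if "\<And>t. 0 \<le> t \<Longrightarrow> a \<le> p (x + t *\<^sub>R z) - t * p z" for a x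
    unfolding q_def using that by (intro cINF_greatest) auto
  have "sublinear q"
  proof (rule sublinearI)
    fix x y
    have "q (x + y) - (p (x + t *\<^sub>R z) - t * p z) \<le> p (y + s *\<^sub>R z) - s * p z" if "0 \<le> t" "0 \<le> s" for s t
      using le[of "t + s" "x + y"] sublinear_add[OF p, of "x + t *\<^sub>R z" "y + s *\<^sub>R z"] that
      by (simp add: algebra_simps)
    then have "q (x + y) - (p (x + t *\<^sub>R z) - t * p z) \<le> q y" if "0 \<le> t" for t
      using that by (intro greatest)
    then have "q (x + y) - q y \<le> p (x + t *\<^sub>R z) - t * p z" if "0 \<le> t" for t
      using that by (fastforce simp: algebra_simps)
    then have "q (x + y) - q y \<le> q x"
      by (rule greatest)
    then show "q (x + y) \<le> q x + q y"
      by simp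
  next
    fix c :: real and x
    assume "0 < c"
    have "q (c *\<^sub>R x) / c \<le> p (x + t *\<^sub>R z) - t * p z" if "0 \<le> t" for t
    proof -
      have "q (c *\<^sub>R x) \<le> p (c *\<^sub>R (x + t *\<^sub>R z)) - (c * t) * p z"
        using le[of "c * t" "c *\<^sub>R x"] that \<open>0 < c\<close> by (simp add: scaleR_add_right)
      also have "p (c *\<^sub>R (x + t *\<^sub>R z)) = c * p (x + t *\<^sub>R z)"
        using \<open>0 < c\<close> by (intro sublinear_scaleR[OF p]) simp
      finally show ?thesis
        using \<open>0 < c\<close> by (simp add: field_simps)
    qed
    then have "q (c *\<^sub>R x) / c \<le> q x"
      by (rule greatest)
    then show "q (c *\<^sub>R x) \<le> c * q x"
      using \<open>0 < c\<close> by (simp add: field_simps)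
  next
    show "q 0 = 0"
      using le[of 0 0] sublinear_0[OF p]
      by (intro antisym greatest) (simp_all add: sublinear_scaleR[OF p])
  qed
  moreover have "q \<le> p"
    using le[of 0] by (simp add: le_fun_def)
  moreover have "q (- z) \<le> - p z"
    using le[of 1 "- z"] sublinear_0[OF p] by simp
  ultimately show thesis
    by (rule that)
qed

text \<open>The pointwise infimum of the chain does it: the bound \<open>-p(-x) \<le> q(x)\<close>, valid for every sublinear
  \<open>q \<le> p\<close>, makes it finite, and subadditivity survives because of any two members of the chain one is
  the smaller.\<close>

lemma sublinear_Inf_chain:
  assumes C: "\<And>q. q \<in> C \<Longrightarrow> sublinear q" "\<And>q r. q \<in> C \<Longrightarrow> r \<in> C \<Longrightarrow> q \<le> r \<or> r \<le> q"
    and p: "sublinear p" "\<And>q. q \<in> C \<Longrightarrow> q \<le> p" and "C \<noteq> {}"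
  obtains l where "sublinear l" "\<And>q. q \<in> C \<Longrightarrow> l \<le> q"
proof -
  define l where "l x = (INF q\<in>C. q x)" for x
  have "- p (- x) \<le> q x" if "q \<in> C" for q x
    using sublinear_minus[OF C(1)[OF that], of x] le_funD[OF p(2)[OF that], of "- x"] by simp
  then have bdd: "bdd_below ((\<lambda>q. q x) ` C)" for x
    by (intro bdd_belowI2[of _ "- p (- x)"])
  have le: "l x \<le> q x" if "q \<in> C" for q x
    unfolding l_def using that by (intro cINF_lower[OF bdd])
  have greatest: "a \<le> l x" if "\<And>q. q \<in> C \<Longrightarrow> a \<le> q x" for a x
    unfolding l_def using that \<open>C \<noteq> {}\<close> by (intro cINF_greatest)
  have "sublinear l"
  proof (rule sublinearI)
    fix x y
    have "l (x + y) \<le> q x + r y" if qr: "q \<in> C" "r \<in> C" for q r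
    proof (cases "q \<le> r")
      case True
      then show ?thesis
        using le[OF qr(1), of "x + y"] sublinear_add[OF C(1)[OF qr(1)], of x y] le_funD[OF True, of y]
        by simp
    next
      case False
      then have "r \<le> q"
        using C(2)[OF qr] by simp
      then show ?thesis
        using le[OF qr(2), of "x + y"] sublinear_add[OF C(1)[OF qr(2)], of x y]
          le_funD[OF \<open>r \<le> q\<close>, of x] by simp
    qed
    then have "l (x + y) - q x \<le> l y" if "q \<in> C" for q
      using that by (intro greatest) (fastforce simp: algebra_simps)
    then have "l (x + y) - l y \<le> l x"
      by (intro greatest) (simp add: algebra_simps)
    then show "l (x + y) \<le> l x + l y"
      by simp
  next
    fix c :: real and x
    assume "0 < c"
    have "l (c *\<^sub>R x) / c \<le> q x" if "q \<in> C" for q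
      using le[OF that, of "c *\<^sub>R x"] sublinear_scaleR[OF C(1)[OF that], of c x] \<open>0 < c\<close>
      by (simp add: field_simps)
    then have "l (c *\<^sub>R x) / c \<le> l x"
      by (rule greatest)
    then show "l (c *\<^sub>R x) \<le> c * l x"
      using \<open>0 < c\<close> by (simp add: field_simps)
  next
    show "l 0 = 0"
      using \<open>C \<noteq> {}\<close> by (simp add: l_def sublinear_0[OF C(1)])
  qed
  moreover have "l \<le> q" if "q \<in> C" for q
    using le[OF that] by (simp add: le_fun_def)
  ultimately show thesis
    by (rule that)
qed

text \<open>A minimal sublinear function cannot be flattened any further, hence is odd, hence linear; Zorn's
  lemma provides one below any given sublinear function.\<close>

theorem linear_below_sublinear:
  assumes p: "sublinear p"
  obtains \<phi> where "linear \<phi>" "\<And>x. \<phi> x \<le> p x"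
proof -
  define A where "A = {q. sublinear q \<and> q \<le> p}"
  define P where "P = (\<lambda>q r :: 'a \<Rightarrow> real. r \<le> q)"
  have "\<exists>m\<in>A. \<forall>a\<in>A. P m a \<longrightarrow> a = m"
  proof (rule predicate_Zorn)
    show "partial_order_on A (relation_of P A)"
      by (rule partial_order_on_relation_ofI) (auto simp: P_def)
    fix C assume C: "C \<in> Chains (relation_of P A)"
    show "\<exists>u\<in>A. \<forall>a\<in>C. P a u"
    proof (cases "C = {}")
      case True
      then show ?thesis
        using p by (auto simp: A_def)
    next
      case False
      have mem: "q \<in> A" if "q \<in> C" for q
        using C that by (auto simp: Chains_def relation_of_def)
      obtain l where l: "sublinear l" "\<And>q. q \<in> C \<Longrightarrow> l \<le> q"
      proof (rule sublinear_Inf_chain[OF _ _ p _ False])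
        show "q \<le> r \<or> r \<le> q" if "q \<in> C" "r \<in> C" for q r
          using C that by (auto simp: Chains_def relation_of_def P_def)
      qed (use mem in \<open>auto simp: A_def\<close>)
      moreover have "l \<le> p"
        using False l(2) mem by (fastforce simp: A_def)
      ultimately show ?thesis
        by (auto simp: A_def P_def)
    qed
  qed
  then obtain m where m: "sublinear m" "m \<le> p"
    and minimal: "\<And>q. sublinear q \<Longrightarrow> q \<le> m \<Longrightarrow> q = m"
    by (auto simp: A_def P_def)
  have odd: "m (- z) = - m z" for z
    using sublinear_flatten[OF m(1), of z] minimal sublinear_minus[OF m(1), of z] by (smt (verit))
  have "linear m"
  proof (rule linearI)
    show "m (x + y) = m x + m y" for x y
      using sublinear_add[OF m(1), of x y] sublinear_add[OF m(1), of "- x" "- y"] odd[of "x + y"]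
      by (simp add: odd)
    show "m (c *\<^sub>R x) = c *\<^sub>R m x" for c x
    proof (cases "0 \<le> c")
      case False
      then show ?thesis
        using sublinear_scaleR[OF m(1), of "- c" x] odd[of "c *\<^sub>R x"] by simp
    qed (simp add: sublinear_scaleR[OF m(1)])
  qed
  with m(2) show thesis
    by (intro that) (auto simp: le_fun_def)
qed

lemma subspace_projection:
  fixes V :: "'v::real_vector set"
  assumes "subspace V"
  obtains \<pi> where "linear \<pi>" "\<And>x. \<pi> x \<in> V" "\<And>x. x \<in> V \<Longrightarrow> \<pi> x = x"
proof -
  obtain \<pi> where "range \<pi> \<subseteq> V" "linear \<pi>" "\<forall>v\<in>V. \<pi> (id v) = v"
    using linear_exists_left_inverse_on[OF linear_id assms] by auto
  then show thesis
    by (intro that[of \<pi>]) auto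
qed

theorem norming_functional:
  assumes E: "normed_space E" and z: "z \<in> vecs E"
  obtains \<phi> where "\<phi> \<in> vecs (dual_of E)" "nrm (dual_of E) \<phi> \<le> 1" "\<phi> z = nrm E z"
proof -
  obtain \<pi> where \<pi>: "linear \<pi>" "\<And>x. \<pi> x \<in> vecs E" "\<And>x. x \<in> vecs E \<Longrightarrow> \<pi> x = x"
    using subspace_projection[OF normed_space_subspace[OF E]] by blast
  \<comment> \<open>The projection extends the norm to a sublinear function on the whole type.\<close>
  have "sublinear (\<lambda>x. nrm E (\<pi> x))"
    using \<pi> by (auto simp: sublinear_def linear_add linear_scale nrm_triangle[OF E] nrm_scaleR[OF E])
  \<comment> \<open>Flattening along \<open>z\<close> first makes the functional attain the norm at \<open>z\<close>.\<close>
  then obtain q where q: "sublinear q" "q \<le> (\<lambda>x. nrm E (\<pi> x))" "q (- z) \<le> - nrm E (\<pi> z)"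
    by (rule sublinear_flatten)
  obtain \<psi> where \<psi>: "linear \<psi>" "\<And>x. \<psi> x \<le> q x"
    using linear_below_sublinear[OF q(1)] by blast
  have le: "\<psi> x \<le> nrm E x" if "x \<in> vecs E" for x
    using \<psi>(2)[of x] le_funD[OF q(2), of x] \<pi>(3)[OF that] by simp
  have abs_le: "\<bar>\<psi> x\<bar> \<le> 1 * nrm E x" if "x \<in> vecs E" for x
    using le[OF that] le[OF vecs_scaleR[OF E that, of "-1"]] nrm_scaleR[OF E that, of "-1"]
    by (simp add: linear_neg[OF \<psi>(1)])
  define \<phi> where "\<phi> x = (if x \<in> vecs E then \<psi> x else 0)" for x
  have "\<phi> \<in> vecs (dual_of E)"
    by (rule dual_ofI[where K = 1])
      (use abs_le in \<open>simp_all add: \<phi>_def vecs_add[OF E] vecs_scaleR[OF E] linear_add[OF \<psi>(1)] linear_scale[OF \<psi>(1)]\<close>)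
  moreover have "nrm (dual_of E) \<phi> \<le> 1"
    using abs_le by (intro nrm_dual_le[OF E]) (simp_all add: \<phi>_def)
  moreover have "\<phi> z = nrm E z"
    using le[OF z] \<psi>(2)[of "- z"] q(3) \<pi>(3)[OF z] z by (simp add: \<phi>_def linear_neg[OF \<psi>(1)])
  ultimately show thesis
    by (rule that)
qed

lemma bidual_embedding_apply:
  "\<phi> \<in> vecs (dual_of E) \<Longrightarrow> bidual_embedding E x \<phi> = \<phi> x"
  by (simp add: bidual_embedding_def)

lemma linear_map_bidual_embedding:
  assumes E: "normed_space E"
  shows "linear_map E (dual_of (dual_of E)) (bidual_embedding E)"
  unfolding linear_map_def
proof (intro conjI ballI allI)
  show "bidual_embedding E \<in> vecs E \<rightarrow> vecs (dual_of (dual_of E))"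
  proof
    fix x assume x: "x \<in> vecs E"
    show "bidual_embedding E x \<in> vecs (dual_of (dual_of E))"
      by (rule dual_ofI[where K = "nrm E x"])
        (use abs_dual_le[OF E _ x] in \<open>simp_all add: bidual_embedding_def mult.commute
            vecs_add[OF normed_space_dual_of[OF E]] vecs_scaleR[OF normed_space_dual_of[OF E]]\<close>)
  qed
qed (auto simp: bidual_embedding_def fun_eq_iff dual_add dual_scaleR)

lemma nrm_bidual_embedding:
  assumes E: "normed_space E" and x: "x \<in> vecs E"
  shows "nrm (dual_of (dual_of E)) (bidual_embedding E x) = nrm E x"
proof (rule antisym)
  show "nrm (dual_of (dual_of E)) (bidual_embedding E x) \<le> nrm E x"
    using abs_dual_le[OF E _ x]
    by (intro nrm_dual_le[OF normed_space_dual_of[OF E]] nrm_nonneg[OF E x])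
      (simp add: bidual_embedding_apply mult.commute)
  obtain \<phi> where \<phi>: "\<phi> \<in> vecs (dual_of E)" "nrm (dual_of E) \<phi> \<le> 1" "\<phi> x = nrm E x"
    using norming_functional[OF E x] .
  have J: "bidual_embedding E x \<in> vecs (dual_of (dual_of E))"
    using linear_map_in[OF linear_map_bidual_embedding[OF E] x] .
  have "nrm E x \<le> nrm (dual_of (dual_of E)) (bidual_embedding E x) * nrm (dual_of E) \<phi>"
    using abs_dual_le[OF normed_space_dual_of[OF E] J \<phi>(1)] \<phi>(3)
    by (simp add: bidual_embedding_apply[OF \<phi>(1)])
  also have "\<dots> \<le> nrm (dual_of (dual_of E)) (bidual_embedding E x) * 1"
    by (intro mult_left_mono \<phi>(2) nrm_dual_nonneg[OF normed_space_dual_of[OF E] J])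
  finally show "nrm E x \<le> nrm (dual_of (dual_of E)) (bidual_embedding E x)"
    by simp
qed


section \<open>Isometric copies\<close>

lemma isometry_inj_on:
  assumes "normed_space E" and "normed_space F" and T: "linear_map E F T"
    and iso: "\<And>x. x \<in> vecs E \<Longrightarrow> nrm F (T x) = nrm E x"
  shows "inj_on T (vecs E)"
proof (rule inj_onI)
  fix x y assume xy: "x \<in> vecs E" "y \<in> vecs E" "T x = T y"
  then have "nrm E (x - y) = nrm F 0"
    using iso[OF vecs_diff[OF assms(1) xy(1,2)]] linear_map_diff[OF T assms(1) xy(1,2)] by simp
  then show "x = y"
    using nrm_eq_0_iff[OF assms(1) vecs_diff[OF assms(1) xy(1,2)]] nrm_0[OF assms(2)] by simp
qed

lemma isometrically_isomorphicE:
  assumes "isometrically_isomorphic E F" and E: "normed_space E"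
  obtains T S where "linear_map E F T" "linear_map F E S"
    "\<And>x. x \<in> vecs E \<Longrightarrow> S (T x) = x" "\<And>y. y \<in> vecs F \<Longrightarrow> T (S y) = y"
    "\<And>x. x \<in> vecs E \<Longrightarrow> nrm F (T x) = nrm E x" "\<And>y. y \<in> vecs F \<Longrightarrow> nrm E (S y) = nrm F y"
proof -
  obtain T where T: "linear_map E F T" "bij_betw T (vecs E) (vecs F)"
    and iso: "\<And>x. x \<in> vecs E \<Longrightarrow> nrm F (T x) = nrm E x"
    using assms(1) by (auto simp: isometrically_isomorphic_def)
  define S where "S = inv_into (vecs E) T"
  have S: "S y \<in> vecs E" and TS: "T (S y) = y" if "y \<in> vecs F" for y
    using that bij_betwE[OF bij_betw_inv_into[OF T(2)]] bij_betw_inv_into_right[OF T(2)]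
    by (auto simp: S_def)
  have ST: "S (T x) = x" if "x \<in> vecs E" for x
    using that bij_betw_inv_into_left[OF T(2)] by (simp add: S_def)
  have "S (y + y') = S y + S y'" if "y \<in> vecs F" "y' \<in> vecs F" for y y'
    using ST[OF vecs_add[OF E S S], OF that] linear_map_add[OF T(1) S S, OF that] that
    by (simp add: TS)
  moreover have "S (c *\<^sub>R y) = c *\<^sub>R S y" if "y \<in> vecs F" for c y
    using ST[OF vecs_scaleR[OF E S], OF that] linear_map_scaleR[OF T(1) S, OF that] that
    by (simp add: TS)
  ultimately have "linear_map F E S"
    using S by (auto simp: linear_map_def)
  then show thesis
    using that[of T S] T(1) ST TS iso iso[OF S] by simp
qed

lemma isometrically_isomorphicI:
  assumes "normed_space E" "normed_space F" "linear_map E F T" "T ` vecs E = vecs F"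
    and "\<And>x. x \<in> vecs E \<Longrightarrow> nrm F (T x) = nrm E x"
  shows "isometrically_isomorphic E F"
  unfolding isometrically_isomorphic_def bij_betw_def
  using assms isometry_inj_on[of E F T] by blast

lemma isometrically_isomorphic_sym:
  assumes "isometrically_isomorphic E F" "normed_space E" "normed_space F"
  shows "isometrically_isomorphic F E"
proof -
  obtain T S where TS: "linear_map E F T" "linear_map F E S"
    "\<And>x. x \<in> vecs E \<Longrightarrow> S (T x) = x" "\<And>y. y \<in> vecs F \<Longrightarrow> T (S y) = y"
    "\<And>x. x \<in> vecs E \<Longrightarrow> nrm F (T x) = nrm E x" "\<And>y. y \<in> vecs F \<Longrightarrow> nrm E (S y) = nrm F y"
    using isometrically_isomorphicE[OF assms(1,2)] by metis
  have "S ` vecs F = vecs E"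
    using linear_map_in[OF TS(1)] linear_map_in[OF TS(2)] TS(3) by force
  then show ?thesis
    by (rule isometrically_isomorphicI[OF assms(3,2) TS(2) _ TS(6)])
qed

lemma isometrically_isomorphic_trans:
  assumes "isometrically_isomorphic E F" "isometrically_isomorphic F G"
  shows "isometrically_isomorphic E G"
proof -
  obtain T where T: "linear_map E F T" "bij_betw T (vecs E) (vecs F)"
    "\<And>x. x \<in> vecs E \<Longrightarrow> nrm F (T x) = nrm E x"
    using assms(1) by (auto simp: isometrically_isomorphic_def)
  obtain S where S: "linear_map F G S" "bij_betw S (vecs F) (vecs G)"
    "\<And>x. x \<in> vecs F \<Longrightarrow> nrm G (S x) = nrm F x"
    using assms(2) by (auto simp: isometrically_isomorphic_def)
  have "linear_map E G (S \<circ> T)"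
    unfolding linear_map_def
    using T(1) S(1) by (auto simp: linear_map_in linear_map_add linear_map_scaleR)
  then show ?thesis
    unfolding isometrically_isomorphic_def
    using bij_betw_trans[OF T(2) S(2)] T(3) S(3) linear_map_in[OF T(1)]
    by (intro exI[of _ "S \<circ> T"]) simp
qed

lemma banach_space_isometric:
  assumes "isometrically_isomorphic E F" and E: "banach_space E" and F: "normed_space F"
  shows "banach_space F"
  unfolding banach_space_iff_Cauchy_convergent
proof (intro conjI F allI impI, elim conjE)
  have E': "normed_space E"
    using E by (rule normed_space_if_banach_space)
  obtain T S where T: "linear_map E F T" and S: "linear_map F E S"
    and TS: "\<And>y. y \<in> vecs F \<Longrightarrow> T (S y) = y"
    and T_iso: "\<And>x. x \<in> vecs E \<Longrightarrow> nrm F (T x) = nrm E x"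
    and S_iso: "\<And>y. y \<in> vecs F \<Longrightarrow> nrm E (S y) = nrm F y"
    using isometrically_isomorphicE[OF assms(1) E'] by metis
  fix \<sigma> :: "nat \<Rightarrow> 'b"
  assume range: "range \<sigma> \<subseteq> vecs F"
    and Cauchy: "\<forall>\<epsilon>>0. \<exists>N. \<forall>m n. N \<le> m \<longrightarrow> N \<le> n \<longrightarrow> nrm F (\<sigma> m - \<sigma> n) < \<epsilon>"
  have \<sigma>: "\<sigma> n \<in> vecs F" for n
    using range by auto
  have "nrm E ((S \<circ> \<sigma>) m - (S \<circ> \<sigma>) n) = nrm F (\<sigma> m - \<sigma> n)" for m n
    using S_iso[OF vecs_diff[OF F \<sigma> \<sigma>]] linear_map_diff[OF S F \<sigma> \<sigma>] by simp
  with Cauchy have "\<forall>\<epsilon>>0. \<exists>N. \<forall>m n. N \<le> m \<longrightarrow> N \<le> n \<longrightarrow> nrm E ((S \<circ> \<sigma>) m - (S \<circ> \<sigma>) n) < \<epsilon>"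
    by simp
  moreover have "range (S \<circ> \<sigma>) \<subseteq> vecs E"
    using linear_map_in[OF S \<sigma>] by auto
  ultimately obtain l where l: "l \<in> vecs E"
    and lim: "\<forall>\<epsilon>>0. \<exists>N. \<forall>n\<ge>N. nrm E ((S \<circ> \<sigma>) n - l) < \<epsilon>"
    using E unfolding banach_space_iff_Cauchy_convergent by blast
  have "nrm F (\<sigma> n - T l) = nrm E ((S \<circ> \<sigma>) n - l)" for n
    using T_iso[OF vecs_diff[OF E' linear_map_in[OF S \<sigma>[of n]] l]]
      linear_map_diff[OF T E' linear_map_in[OF S \<sigma>[of n]] l] TS[OF \<sigma>] by simp
  with lim show "\<exists>l\<in>vecs F. \<forall>\<epsilon>>0. \<exists>N. \<forall>n\<ge>N. nrm F (\<sigma> n - l) < \<epsilon>"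
    using linear_map_in[OF T l] by (intro bexI[of _ "T l"]) simp_all
qed

text \<open>Functionals are pulled back along the isometry and along its inverse. Neither pullback increases
  norms and they are inverse to each other, so both preserve norms.\<close>

lemma dual_of_isometric:
  assumes "isometrically_isomorphic E F" and E: "normed_space E" and F: "normed_space F"
  shows "isometrically_isomorphic (dual_of E) (dual_of F)"
proof -
  obtain T S where T: "linear_map E F T" and S: "linear_map F E S"
    and ST: "\<And>x. x \<in> vecs E \<Longrightarrow> S (T x) = x" and TS: "\<And>y. y \<in> vecs F \<Longrightarrow> T (S y) = y"
    and T_iso: "\<And>x. x \<in> vecs E \<Longrightarrow> nrm F (T x) = nrm E x"
    and S_iso: "\<And>y. y \<in> vecs F \<Longrightarrow> nrm E (S y) = nrm F y"
    using isometrically_isomorphicE[OF assms(1,2)] by metis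
  have pullback: "(\<lambda>y. if y \<in> vecs H then \<phi> (R y) else 0) \<in> vecs (dual_of H) \<and>
      nrm (dual_of H) (\<lambda>y. if y \<in> vecs H then \<phi> (R y) else 0) \<le> nrm (dual_of G) \<phi>"
    if G: "normed_space G" and H: "normed_space H" and R: "linear_map H G R"
      and R_iso: "\<And>y. y \<in> vecs H \<Longrightarrow> nrm G (R y) = nrm H y" and \<phi>: "\<phi> \<in> vecs (dual_of G)"
    for G :: "'c::real_vector nvs" and H :: "'d::real_vector nvs" and R \<phi>
  proof -
    have bound: "\<bar>\<phi> (R y)\<bar> \<le> nrm (dual_of G) \<phi> * nrm H y" if "y \<in> vecs H" for y
      using abs_dual_le[OF G \<phi> linear_map_in[OF R that]] by (simp add: R_iso[OF that])
    show ?thesis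
    proof (intro conjI dual_ofI[where K = "nrm (dual_of G) \<phi>"] nrm_dual_le[OF H] nrm_dual_nonneg[OF G \<phi>])
    qed (use bound in \<open>simp_all add: vecs_add[OF H] vecs_scaleR[OF H] linear_map_add[OF R]
        linear_map_scaleR[OF R] dual_add[OF \<phi>] dual_scaleR[OF \<phi>] linear_map_in[OF R]\<close>)
  qed
  define U where "U \<phi> = (\<lambda>y. if y \<in> vecs F then \<phi> (S y) else 0)" for \<phi> :: "'a \<Rightarrow> real"
  define V where "V \<phi> = (\<lambda>x. if x \<in> vecs E then \<phi> (T x) else 0)" for \<phi> :: "'b \<Rightarrow> real"
  have U: "U \<phi> \<in> vecs (dual_of F)" "nrm (dual_of F) (U \<phi>) \<le> nrm (dual_of E) \<phi>"
    if "\<phi> \<in> vecs (dual_of E)" for \<phi>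
    using pullback[OF E F S S_iso that] by (auto simp: U_def)
  have V: "V \<phi> \<in> vecs (dual_of E)" "nrm (dual_of E) (V \<phi>) \<le> nrm (dual_of F) \<phi>"
    if "\<phi> \<in> vecs (dual_of F)" for \<phi>
    using pullback[OF F E T T_iso that] by (auto simp: V_def)
  have VU: "V (U \<phi>) = \<phi>" if "\<phi> \<in> vecs (dual_of E)" for \<phi>
    using dual_outside[OF that] by (auto simp: U_def V_def fun_eq_iff ST linear_map_in[OF T])
  have UV: "U (V \<phi>) = \<phi>" if "\<phi> \<in> vecs (dual_of F)" for \<phi>
    using dual_outside[OF that] by (auto simp: U_def V_def fun_eq_iff TS linear_map_in[OF S])
  show ?thesis
  proof (rule isometrically_isomorphicI[OF normed_space_dual_of[OF E] normed_space_dual_of[OF F]])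
    show "linear_map (dual_of E) (dual_of F) U"
      using U(1) by (auto simp: linear_map_def U_def fun_eq_iff)
    show "U ` vecs (dual_of E) = vecs (dual_of F)"
      using U(1) V(1) UV by force
    show "nrm (dual_of F) (U \<phi>) = nrm (dual_of E) \<phi>" if "\<phi> \<in> vecs (dual_of E)" for \<phi>
      using U[OF that] V(2)[OF U(1)[OF that]] VU[OF that] by simp
  qed
qed

definition nvs_image :: "('v::real_vector \<Rightarrow> 'w::real_vector) \<Rightarrow> 'v nvs \<Rightarrow> 'w nvs" where
  "nvs_image h E = \<lparr>vecs = h ` vecs E, nrm = (\<lambda>y. nrm E (inv_into (vecs E) h y))\<rparr>"

lemma vecs_nvs_image [simp]: "vecs (nvs_image h E) = h ` vecs E"
  by (simp add: nvs_image_def)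

lemma
  assumes E: "normed_space E" and inj: "inj_on h (vecs E)"
    and add: "\<And>x y. \<lbrakk>x \<in> vecs E; y \<in> vecs E\<rbrakk> \<Longrightarrow> h (x + y) = h x + h y"
    and scale: "\<And>c x. x \<in> vecs E \<Longrightarrow> h (c *\<^sub>R x) = c *\<^sub>R h x"
  shows normed_space_nvs_image: "normed_space (nvs_image h E)"
    and linear_map_nvs_image: "linear_map E (nvs_image h E) h"
    and isometrically_isomorphic_nvs_image: "isometrically_isomorphic E (nvs_image h E)"
proof -
  have nrm: "nrm (nvs_image h E) (h x) = nrm E x" if "x \<in> vecs E" for x
    using that inj by (simp add: nvs_image_def)
  show lin: "linear_map E (nvs_image h E) h"
    using add scale by (auto simp: linear_map_def)
  have h_0: "h 0 = 0"
    using linear_map_0[OF lin E] .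
  have "subspace (h ` vecs E)"
    unfolding subspace_def
  proof (intro conjI ballI allI)
    show "0 \<in> h ` vecs E"
      using h_0 vecs_0[OF E] by force
  qed (auto simp: add[symmetric] scale[symmetric] vecs_add[OF E] vecs_scaleR[OF E])
  moreover have "nrm (nvs_image h E) y = 0 \<longleftrightarrow> y = 0" if "y \<in> h ` vecs E" for y
    using that inj_onD[OF inj, of _ 0] vecs_0[OF E] nrm[of 0]
    by (auto simp: nrm nrm_eq_0_iff[OF E] h_0 nrm_0[OF E])
  ultimately show image: "normed_space (nvs_image h E)"
    unfolding normed_space_def
    by (auto simp: add[symmetric] scale[symmetric] vecs_add[OF E] vecs_scaleR[OF E] nrm
        nrm_nonneg[OF E] nrm_scaleR[OF E] nrm_triangle[OF E])
  show "isometrically_isomorphic E (nvs_image h E)"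
    by (rule isometrically_isomorphicI[OF E image lin]) (simp_all add: nrm)
qed


section \<open>Finite-dimensional spaces are dual spaces\<close>

lemma sum_fun_eval: "(\<Sum>b\<in>B. f b) x = (\<Sum>b\<in>B. f b x)" for f :: "'c \<Rightarrow> 'b \<Rightarrow> real"
  by (induction B rule: infinite_finite_induct) simp_all

lemma dual_sum:
  assumes "\<phi> \<in> vecs (dual_of E)" and E: "normed_space E" and "finite B"
    and "\<And>b. b \<in> B \<Longrightarrow> g b \<in> vecs E"
  shows "\<phi> (\<Sum>b\<in>B. g b) = (\<Sum>b\<in>B. \<phi> (g b))"
  using assms(3,4)
proof (induction B)
  case empty
  then show ?case
    by (simp add: dual_0[OF assms(1) E])
next
  case (insert b B)
  have "sum g B \<in> vecs E"
    using insert.prems by (intro subspace_sum normed_space_subspace[OF E]) auto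
  then show ?case
    using insert by (simp add: dual_add[OF assms(1)])
qed

lemma subspace_basis_card_le:
  assumes "subspace V" "V \<subseteq> span S" "finite S"
  obtains C where "independent C" "finite C" "span C = V" "card C \<le> card S"
proof -
  obtain C where C: "C \<subseteq> V" "independent C" "V \<subseteq> span C"
    using maximal_independent_subset by blast
  moreover have "finite C \<and> card C \<le> card S"
    using C assms by (intro independent_span_bound) auto
  moreover have "span C = V"
    using C(1,3) assms(1) by (simp add: span_minimal subset_antisym)
  ultimately show thesis
    using that by blast
qed

text \<open>Functionals on \<open>E\<close> are linear combinations of the coordinate functionals of a basis. These may a
  priori be unbounded and lie outside the dual, so a basis of the dual is chosen anew, inside the
  span of the coordinate functionals.\<close>

lemma dual_basis_card_le:
  assumes E: "normed_space E" and B: "independent B" "finite B" "span B = vecs E"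
  obtains C where "independent C" "finite C" "span C = vecs (dual_of E)" "card C \<le> card B"
proof -
  define \<kappa> where "\<kappa> b x = (if x \<in> vecs E then representation B x b else 0)" for b x
  have "vecs (dual_of E) \<subseteq> span (\<kappa> ` B)"
  proof
    fix \<phi> assume \<phi>: "\<phi> \<in> vecs (dual_of E)"
    have "\<phi> x = (\<Sum>b\<in>B. \<phi> b *\<^sub>R \<kappa> b) x" for x
    proof (cases "x \<in> vecs E")
      case True
      have mem: "b \<in> vecs E" if "b \<in> B" for b
        using that B(3) span_base by blast
      have "\<phi> x = \<phi> (\<Sum>b\<in>B. representation B x b *\<^sub>R b)"
        using True B by (subst sum_representation_eq[of B x B]) auto
      also have "\<dots> = (\<Sum>b\<in>B. representation B x b * \<phi> b)"
        using mem by (simp add: dual_sum[OF \<phi> E B(2)] vecs_scaleR[OF E] dual_scaleR[OF \<phi>])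
      finally show ?thesis
        using True by (simp add: \<kappa>_def sum_fun_eval mult.commute)
    next
      case False
      then show ?thesis
        using dual_outside[OF \<phi>] by (simp add: \<kappa>_def sum_fun_eval)
    qed
    then have "\<phi> = (\<Sum>b\<in>B. \<phi> b *\<^sub>R \<kappa> b)"
      by (rule ext)
    also have "\<dots> \<in> span (\<kappa> ` B)"
      by (intro span_sum span_scale span_base) auto
    finally show "\<phi> \<in> span (\<kappa> ` B)" .
  qed
  then obtain C where C: "independent C" "finite C" "span C = vecs (dual_of E)" "card C \<le> card (\<kappa> ` B)"
    using subspace_basis_card_le[OF normed_space_subspace[OF normed_space_dual_of[OF E]]] B(2) by blast
  moreover have "card (\<kappa> ` B) \<le> card B"
    using B(2) by (rule card_image_le)
  ultimately show thesis
    using that by auto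
qed

lemma finite_dimensional_basis:
  assumes "finite_dimensional E"
  obtains B where "independent B" "finite B" "span B = vecs E"
proof -
  obtain S where "finite S" "vecs E = span S"
    using assms by (auto simp: finite_dimensional_def)
  then show thesis
    using subspace_basis_card_le[OF subspace_span order_refl, of S] that by metis
qed

text \<open>Passing to the dual does not increase the dimension of a finite-dimensional space, and the
  canonical embedding is injective; so it maps a basis to a linearly independent set that is too
  large not to span the bidual.\<close>

lemma bidual_embedding_surj:
  assumes E: "normed_space E" and "finite_dimensional E"
  shows "bidual_embedding E ` vecs E = vecs (dual_of (dual_of E))"
proof -
  let ?J = "bidual_embedding E" and ?DD = "dual_of (dual_of E)"
  have D: "normed_space (dual_of E)" and DD: "normed_space ?DD"
    using E by (auto intro!: normed_space_dual_of)
  have J: "linear_map E ?DD ?J"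
    by (rule linear_map_bidual_embedding[OF E])
  obtain B where B: "independent B" "finite B" "span B = vecs E"
    using finite_dimensional_basis[OF assms(2)] .
  obtain C where C: "independent C" "finite C" "span C = vecs (dual_of E)" "card C \<le> card B"
    using dual_basis_card_le[OF E B] .
  obtain C' where C': "independent C'" "finite C'" "span C' = vecs ?DD" "card C' \<le> card C"
    using dual_basis_card_le[OF D C(1-3)] .
  \<comment> \<open>The canonical embedding is linear on the carrier only.\<close>
  obtain \<pi> where \<pi>: "linear \<pi>" "\<And>x. \<pi> x \<in> vecs E" "\<And>x. x \<in> vecs E \<Longrightarrow> \<pi> x = x"
    using subspace_projection[OF normed_space_subspace[OF E]] by blast
  have lin: "linear (?J \<circ> \<pi>)"
    by (rule linearI) (simp_all add: linear_add[OF \<pi>(1)] linear_scale[OF \<pi>(1)] \<pi>(2)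
        linear_map_add[OF J] linear_map_scaleR[OF J])
  have inj: "inj_on (?J \<circ> \<pi>) (span B)"
    using isometry_inj_on[OF E DD J nrm_bidual_embedding[OF E]]
    by (auto simp: B(3) \<pi>(3) inj_on_def)
  have image: "(?J \<circ> \<pi>) ` span B = ?J ` vecs E"
    by (auto simp: B(3) \<pi>(3))
  have indep: "independent ((?J \<circ> \<pi>) ` B)"
    by (rule linear_independent_injective_image[OF lin B(1) inj])
  have card: "card ((?J \<circ> \<pi>) ` B) = card B"
    using inj by (intro card_image) (meson inj_on_subset span_superset)
  have "\<Psi> \<in> span ((?J \<circ> \<pi>) ` B)" if "\<Psi> \<in> vecs ?DD" for \<Psi>
  proof (rule ccontr)
    assume notin: "\<Psi> \<notin> span ((?J \<circ> \<pi>) ` B)"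
    have "insert \<Psi> ((?J \<circ> \<pi>) ` B) \<subseteq> span C'"
      using that \<pi>(2) linear_map_in[OF J] by (auto simp: C'(3))
    then have "card (insert \<Psi> ((?J \<circ> \<pi>) ` B)) \<le> card C'"
      using independent_span_bound[OF C'(2) independent_insertI[OF notin indep]] by simp
    moreover have "card (insert \<Psi> ((?J \<circ> \<pi>) ` B)) = Suc (card B)"
      using notin span_base B(2) card by (metis card_insert_disjoint finite_imageI)
    ultimately show False
      using C(4) C'(4) by simp
  qed
  moreover have "span ((?J \<circ> \<pi>) ` B) = ?J ` vecs E"
    by (simp only: linear_span_image[OF lin] image)
  ultimately have "vecs ?DD \<subseteq> ?J ` vecs E"
    by blast
  then show ?thesis
    using linear_map_in[OF J] by auto
qed

text \<open>The dual of \<open>E\<close> serves as the predual.\<close>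

lemma dual_banach_space_if_finite_dimensional:
  assumes "banach_space E" "finite_dimensional E"
  shows "dual_banach_space E"
proof -
  have E: "normed_space E"
    using assms(1) by (rule normed_space_if_banach_space)
  have DD: "normed_space (dual_of (dual_of E))"
    by (intro normed_space_dual_of E)
  have "isometrically_isomorphic E (dual_of (dual_of E))"
    by (rule isometrically_isomorphicI[OF E DD linear_map_bidual_embedding[OF E]
          bidual_embedding_surj[OF E assms(2)] nrm_bidual_embedding[OF E]])
  then have "isometrically_isomorphic (dual_of (dual_of E)) E"
    by (rule isometrically_isomorphic_sym[OF _ E DD])
  then show ?thesis
    using assms(1) banach_space_dual_of[OF E] by (auto simp: dual_banach_space_def)
qed


section \<open>Lipschitz maps\<close>

lemma mdist_self [simp]: "x \<in> mspace m \<Longrightarrow> mdist m x x = 0"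
  by simp

lemma
  assumes "Lipschitz_continuous_map m1 m2 f"
  shows Lip_nonneg: "0 \<le> Lip m1 m2 f"
    and lipschitz_map_Lip: "lipschitz_map (Lip m1 m2 f) m1 m2 f"
proof -
  let ?S = "{L. 0 \<le> L \<and> lipschitz_map L m1 m2 f}"
  obtain B where B: "B > 0" "lipschitz_map B m1 m2 f"
    using assms unfolding Lipschitz_continuous_map_pos lipschitz_map_def by blast
  then have ne: "?S \<noteq> {}"
    by (auto intro: less_imp_le)
  show "0 \<le> Lip m1 m2 f"
    unfolding Lip_def using ne by (rule cInf_greatest) simp
  have "mdist m2 (f x) (f y) \<le> Lip m1 m2 f * mdist m1 x y" if xy: "x \<in> mspace m1" "y \<in> mspace m1" for x y
  proof (cases "mdist m1 x y = 0")
    case True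
    have "mdist m2 (f x) (f y) \<le> B * mdist m1 x y"
      using B(2) xy by (simp add: lipschitz_map_def)
    then show ?thesis
      by (simp only: True mult_zero_right)
  next
    case False
    then have pos: "mdist m1 x y > 0"
      using mdist_nonneg[of m1 x y] by linarith
    have "mdist m2 (f x) (f y) / mdist m1 x y \<le> Lip m1 m2 f"
      unfolding Lip_def using ne
      by (rule cInf_greatest) (use pos xy in \<open>auto simp: lipschitz_map_def field_simps\<close>)
    then show ?thesis
      using pos by (simp add: field_simps)
  qed
  then show "lipschitz_map (Lip m1 m2 f) m1 m2 f"
    using assms by (simp add: lipschitz_map_def Lipschitz_continuous_map_def)
qed

lemma Lip_le: "\<lbrakk>0 \<le> L; lipschitz_map L m1 m2 f\<rbrakk> \<Longrightarrow> Lip m1 m2 f \<le> L"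
  unfolding Lip_def by (intro cInf_lower bdd_belowI[of _ 0]) auto

lemma Lipschitz_continuous_map_if_lipschitz_map:
  "lipschitz_map L m1 m2 f \<Longrightarrow> Lipschitz_continuous_map m1 m2 f"
  by (auto simp: lipschitz_map_def Lipschitz_continuous_map_def)

lemma lipschitz_map_mono: "\<lbrakk>lipschitz_map K m1 m2 f; K \<le> L\<rbrakk> \<Longrightarrow> lipschitz_map L m1 m2 f"
  unfolding lipschitz_map_def by (meson mult_right_mono mdist_nonneg order_trans)

lemma lipschitz_map_compose:
  assumes "lipschitz_map L m1 m2 f" "lipschitz_map K m2 m3 g" "0 \<le> K"
  shows "lipschitz_map (K * L) m1 m3 (g \<circ> f)"
  unfolding lipschitz_map_def
proof (intro conjI ballI)
  have f: "f x \<in> mspace m2" if "x \<in> mspace m1" for x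
    using assms(1) that by (auto simp: lipschitz_map_def)
  show "g \<circ> f \<in> mspace m1 \<rightarrow> mspace m3"
    using f assms(2) by (auto simp: lipschitz_map_def)
  fix x y assume xy: "x \<in> mspace m1" "y \<in> mspace m1"
  have "mdist m3 (g (f x)) (g (f y)) \<le> K * mdist m2 (f x) (f y)"
    using assms(2) f xy by (simp add: lipschitz_map_def)
  also have "\<dots> \<le> K * (L * mdist m1 x y)"
    using assms(1,3) xy by (intro mult_left_mono) (auto simp: lipschitz_map_def)
  finally show "mdist m3 ((g \<circ> f) x) ((g \<circ> f) y) \<le> K * L * mdist m1 x y"
    by (simp add: mult.assoc)
qed

lemma lipschitz_map_isometry:
  assumes E: "normed_space E" and F: "normed_space F" and T: "linear_map E F T"
    and iso: "\<And>x. x \<in> vecs E \<Longrightarrow> nrm F (T x) = nrm E x"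
  shows "lipschitz_map 1 (norm_metric E) (norm_metric F) T"
  unfolding lipschitz_map_def
  using linear_map_in[OF T] iso[OF vecs_diff[OF E]] linear_map_diff[OF T E]
  by (simp add: mspace_norm_metric[OF E] mspace_norm_metric[OF F] mdist_norm_metric[OF E]
      mdist_norm_metric[OF F])

text \<open>The extension restricts to \<open>f\<close>, so \<open>Lip(f)\<close> is at most its Lipschitz constant.\<close>

lemma one_le_ext_const:
  assumes f: "Lipschitz_continuous_map (submetric Y X) (norm_metric E) f" and X: "X \<subseteq> mspace Y"
    and pos: "0 < Lip (submetric Y X) (norm_metric E) f"
  shows "1 \<le> ext_const X Y E f"
  unfolding ext_const_def
proof (rule Inf_greatest, clarify)
  let ?L = "Lip (submetric Y X) (norm_metric E) f"
  fix K :: real and g assume K: "0 \<le> K" and g: "lipschitz_map (K * ?L) Y (norm_metric E) g"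
    and gf: "\<forall>x\<in>X. g x = f x"
  have "f x \<in> mspace (norm_metric E)" if "x \<in> X" for x
    using f that X by (auto simp: Lipschitz_continuous_map_def)
  moreover have "mdist (norm_metric E) (f x) (f y) \<le> K * ?L * mdist Y x y" if "x \<in> X" "y \<in> X" for x y
    using g gf that X by (metis lipschitz_map_def subsetD)
  ultimately have "lipschitz_map (K * ?L) (submetric Y X) (norm_metric E) f"
    by (simp add: lipschitz_map_def)
  then have "?L \<le> K * ?L"
    using K pos by (intro Lip_le) auto
  then show "1 \<le> ennreal K"
    using pos by simp
qed

text \<open>A function on \<open>X\<close> is represented by any function on the whole type that restricts to it.\<close>

definition lip_real :: "'a metric \<Rightarrow> 'a set \<Rightarrow> real \<Rightarrow> ('a \<Rightarrow> real) \<Rightarrow> bool" where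
  "lip_real Y X L f \<longleftrightarrow> (\<forall>x\<in>X. \<forall>x'\<in>X. \<bar>f x - f x'\<bar> \<le> L * mdist Y x x')"

lemma lip_realD: "\<lbrakk>lip_real Y X L f; x \<in> X; x' \<in> X\<rbrakk> \<Longrightarrow> \<bar>f x - f x'\<bar> \<le> L * mdist Y x x'"
  by (simp add: lip_real_def)

lemma lip_real_mono: "\<lbrakk>lip_real Y X K f; K \<le> L; X' \<subseteq> X\<rbrakk> \<Longrightarrow> lip_real Y X' L f"
  unfolding lip_real_def by (meson mult_right_mono mdist_nonneg order_trans subsetD)

lemma lip_real_abs: "lip_real Y X L f \<Longrightarrow> lip_real Y X \<bar>L\<bar> f"
  by (rule lip_real_mono) auto

lemma lip_real_add:
  "\<lbrakk>lip_real Y X K f; lip_real Y X L g\<rbrakk> \<Longrightarrow> lip_real Y X (K + L) (f + g)"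
  unfolding lip_real_def by (fastforce simp: distrib_right)

lemma lip_real_scaleR:
  assumes "lip_real Y X L f"
  shows "lip_real Y X (\<bar>a\<bar> * L) (a *\<^sub>R f)"
  unfolding lip_real_def
proof (intro ballI)
  fix x x' assume "x \<in> X" "x' \<in> X"
  then show "\<bar>(a *\<^sub>R f) x - (a *\<^sub>R f) x'\<bar> \<le> \<bar>a\<bar> * L * mdist Y x x'"
    using mult_left_mono[OF lip_realD[OF assms], of x x' "\<bar>a\<bar>"]
    by (simp add: abs_mult[symmetric] right_diff_distrib mult.assoc)
qed

lemma lip_real_submetric [simp]: "lip_real (submetric Y A) X L f \<longleftrightarrow> lip_real Y X L f"
  by (simp add: lip_real_def)


section \<open>The space of Lipschitz functions\<close>

lemma vecs_Lip0_iff: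
  "f \<in> vecs (Lip0 p m) \<longleftrightarrow>
     (\<exists>L. lip_real m (mspace m) L f) \<and> f p = 0 \<and> (\<forall>x. x \<notin> mspace m \<longrightarrow> f x = 0)"
  by (simp add: Lip0_def Lipschitz_continuous_map_def lip_real_def dist_real_def)

lemma nrm_Lip0_le:
  assumes "0 \<le> L" "lip_real m (mspace m) L f"
  shows "nrm (Lip0 p m) f \<le> L"
  unfolding Lip0_def nvs.simps
proof (rule cSup_least)
  fix r assume "r \<in> insert 0 {\<bar>f x - f x'\<bar> / mdist m x x' |x x'. x \<in> mspace m \<and> x' \<in> mspace m \<and> x \<noteq> x'}"
  then consider "r = 0" | x x' where "r = \<bar>f x - f x'\<bar> / mdist m x x'" "x \<in> mspace m" "x' \<in> mspace m" "x \<noteq> x'"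
    by auto
  then show "r \<le> L"
  proof cases
    case 2
    then have "mdist m x x' > 0"
      using mdist_nonneg[of m x x'] mdist_zero[of x m x'] by linarith
    then show ?thesis
      using lip_realD[OF assms(2) 2(2,3)] 2(1) by (simp add: pos_divide_le_eq)
  qed (use assms(1) in simp)
qed simp

lemma
  assumes "f \<in> vecs (Lip0 p m)"
  shows nrm_Lip0_nonneg: "0 \<le> nrm (Lip0 p m) f"
    and lip_real_nrm_Lip0: "lip_real m (mspace m) (nrm (Lip0 p m) f) f"
proof -
  let ?S = "{\<bar>f x - f x'\<bar> / mdist m x x' |x x'. x \<in> mspace m \<and> x' \<in> mspace m \<and> x \<noteq> x'}"
  obtain L where L: "lip_real m (mspace m) L f"
    using assms by (auto simp: vecs_Lip0_iff)
  have pos: "mdist m x x' > 0" if "x \<in> mspace m" "x' \<in> mspace m" "x \<noteq> x'" for x x'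
    using that mdist_nonneg[of m x x'] mdist_zero[of x m x'] by linarith
  have "r \<le> \<bar>L\<bar>" if "r \<in> insert 0 ?S" for r
    using that lip_realD[OF lip_real_abs[OF L]] pos by (auto simp: field_simps)
  then have bdd: "bdd_above (insert 0 ?S)"
    by (auto simp: bdd_above_def)
  have nrm: "nrm (Lip0 p m) f = Sup (insert 0 ?S)"
    by (simp add: Lip0_def)
  show "0 \<le> nrm (Lip0 p m) f"
    unfolding nrm by (rule cSup_upper[OF _ bdd]) simp
  show "lip_real m (mspace m) (nrm (Lip0 p m) f) f"
    unfolding lip_real_def
  proof (intro ballI)
    fix x x' assume xx': "x \<in> mspace m" "x' \<in> mspace m"
    show "\<bar>f x - f x'\<bar> \<le> nrm (Lip0 p m) f * mdist m x x'"
    proof (cases "x = x'")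
      case True
      then show ?thesis
        using xx' by simp
    next
      case False
      then have "\<bar>f x - f x'\<bar> / mdist m x x' \<le> nrm (Lip0 p m) f"
        unfolding nrm using xx' by (intro cSup_upper[OF _ bdd]) auto
      then show ?thesis
        using pos[OF xx' False] by (simp add: field_simps)
    qed
  qed
qed

lemma Lip0I:
  assumes "lip_real m (mspace m) L f" "f p = 0" "\<And>x. x \<notin> mspace m \<Longrightarrow> f x = 0"
  shows "f \<in> vecs (Lip0 p m)"
  using assms by (auto simp: vecs_Lip0_iff)

lemma
  assumes "f \<in> vecs (Lip0 p m)"
  shows Lip0_base: "f p = 0" and Lip0_outside: "x \<notin> mspace m \<Longrightarrow> f x = 0"
  using assms by (auto simp: vecs_Lip0_iff)

lemma abs_Lip0_le:
  assumes "f \<in> vecs (Lip0 p m)" "p \<in> mspace m" "x \<in> mspace m"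
  shows "\<bar>f x\<bar> \<le> nrm (Lip0 p m) f * mdist m x p"
  using lip_realD[OF lip_real_nrm_Lip0[OF assms(1)] assms(3,2)] Lip0_base[OF assms(1)] by simp

lemma normed_space_Lip0:
  assumes p: "p \<in> mspace m"
  shows "normed_space (Lip0 p m)"
proof -
  let ?E = "Lip0 p m"
  have zero: "0 \<in> vecs ?E"
    by (rule Lip0I[where L = 0]) (auto simp: lip_real_def)
  have add: "f + g \<in> vecs ?E" "nrm ?E (f + g) \<le> nrm ?E f + nrm ?E g"
    if "f \<in> vecs ?E" "g \<in> vecs ?E" for f g
  proof -
    have sum: "lip_real m (mspace m) (nrm ?E f + nrm ?E g) (f + g)"
      using that by (intro lip_real_add lip_real_nrm_Lip0)
    show "f + g \<in> vecs ?E"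
      by (rule Lip0I[OF sum]) (use that in \<open>simp_all add: Lip0_base Lip0_outside\<close>)
    show "nrm ?E (f + g) \<le> nrm ?E f + nrm ?E g"
      using that by (intro nrm_Lip0_le sum add_nonneg_nonneg nrm_Lip0_nonneg)
  qed
  have scale_le: "a *\<^sub>R f \<in> vecs ?E" "nrm ?E (a *\<^sub>R f) \<le> \<bar>a\<bar> * nrm ?E f" if "f \<in> vecs ?E" for a f
  proof -
    have mult: "lip_real m (mspace m) (\<bar>a\<bar> * nrm ?E f) (a *\<^sub>R f)"
      using that by (intro lip_real_scaleR lip_real_nrm_Lip0)
    show "a *\<^sub>R f \<in> vecs ?E"
      by (rule Lip0I[OF mult]) (use that in \<open>simp_all add: Lip0_base Lip0_outside\<close>)
    show "nrm ?E (a *\<^sub>R f) \<le> \<bar>a\<bar> * nrm ?E f"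
      using that by (intro nrm_Lip0_le mult mult_nonneg_nonneg nrm_Lip0_nonneg) auto
  qed
  have scale: "nrm ?E (a *\<^sub>R f) = \<bar>a\<bar> * nrm ?E f" if "f \<in> vecs ?E" for a f
  proof (cases "a = 0")
    case True
    then show ?thesis
      using scale_le(2)[OF that, of 0] nrm_Lip0_nonneg[OF zero] by simp
  next
    case False
    then have "nrm ?E f \<le> \<bar>1 / a\<bar> * nrm ?E (a *\<^sub>R f)"
      using scale_le(2)[OF scale_le(1)[OF that], of "1 / a" a] by simp
    with False show ?thesis
      using scale_le(2)[OF that, of a] by (simp add: field_simps)
  qed
  have "nrm ?E f = 0 \<longleftrightarrow> f = 0" if "f \<in> vecs ?E" for f
  proof
    assume "nrm ?E f = 0"
    then have "f x = 0" for x
      using abs_Lip0_le[OF that p, of x] Lip0_outside[OF that, of x] by (cases "x \<in> mspace m") auto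
    then show "f = 0"
      by auto
  next
    assume "f = 0"
    then show "nrm ?E f = 0"
      using scale[OF that, of 0] by simp
  qed
  then show ?thesis
    unfolding normed_space_def subspace_def
    using add scale scale_le zero nrm_Lip0_nonneg by auto
qed

lemma banach_space_Lip0:
  assumes p: "p \<in> mspace m"
  shows "banach_space (Lip0 p m)"
proof (rule banach_space_of_functions[OF normed_space_Lip0[OF p]])
  show "\<exists>C. \<forall>f\<in>vecs (Lip0 p m). \<bar>f x\<bar> \<le> C * nrm (Lip0 p m) f" for x
  proof (cases "x \<in> mspace m")
    case True
    then show ?thesis
      using abs_Lip0_le[OF _ p] by (intro exI[of _ "mdist m x p"]) (simp add: mult.commute)
  next
    case False
    then show ?thesis
      by (intro exI[of _ 0]) (simp add: Lip0_outside)
  qed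
next
  fix f :: "nat \<Rightarrow> 'a \<Rightarrow> real" and l c
  assume f: "f n \<in> vecs (Lip0 p m)" and c: "nrm (Lip0 p m) (f n) \<le> c"
    and l: "(\<lambda>n. f n x) \<longlonglongrightarrow> l x" for n x
  have "0 \<le> c"
    using nrm_Lip0_nonneg[OF f[of 0]] c[of 0] by simp
  have lip: "lip_real m (mspace m) c l"
    unfolding lip_real_def
  proof (intro ballI)
    fix x y assume "x \<in> mspace m" "y \<in> mspace m"
    then have "\<bar>f n x - f n y\<bar> \<le> c * mdist m x y" for n
      using lip_realD[OF lip_real_mono[OF lip_real_nrm_Lip0[OF f] c subset_refl]] by blast
    then show "\<bar>l x - l y\<bar> \<le> c * mdist m x y"
      by (intro LIMSEQ_le_const2[OF tendsto_rabs[OF tendsto_diff[OF l l]]]) blast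
  qed
  have "l x = 0" if "\<And>n. f n x = 0" for x
    using LIMSEQ_unique[OF l[of x]] that by simp
  then have "l \<in> vecs (Lip0 p m)"
    by (intro Lip0I[OF lip]) (simp_all add: Lip0_base[OF f] Lip0_outside[OF f])
  then show "l \<in> vecs (Lip0 p m) \<and> nrm (Lip0 p m) l \<le> c"
    using nrm_Lip0_le[OF \<open>0 \<le> c\<close> lip] by simp
qed


section \<open>Linear extension without a basepoint\<close>

text \<open>Extending constants by constants turns a linear extension operator on \<open>Lip\<^sub>0(X)\<close> into one on all
  Lipschitz functions, with the same norm. In this form operators for different subsets can be
  compared without matching their basepoints, and the carrier conditions of \<open>Lip\<^sub>0\<close> disappear. The
  last condition is the bound \<open>\<parallel>S\<parallel> \<le> c\<close>.\<close>

definition lip_extender :: "real \<Rightarrow> 'a set \<Rightarrow> 'a metric \<Rightarrow> (('a \<Rightarrow> real) \<Rightarrow> 'a \<Rightarrow> real) \<Rightarrow> bool" where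
  "lip_extender c X Y S \<longleftrightarrow>
     (\<forall>f K g L. lip_real Y X K f \<longrightarrow> lip_real Y X L g \<longrightarrow> (\<forall>y\<in>mspace Y. S (f + g) y = S f y + S g y)) \<and>
     (\<forall>a f L. lip_real Y X L f \<longrightarrow> (\<forall>y\<in>mspace Y. S (a *\<^sub>R f) y = a * S f y)) \<and>
     (\<forall>f L. lip_real Y X L f \<longrightarrow> (\<forall>x\<in>X. S f x = f x)) \<and>
     (\<forall>f L. 0 \<le> L \<longrightarrow> lip_real Y X L f \<longrightarrow> lip_real Y (mspace Y) (c * L) (S f))"

lemma
  assumes "lip_extender c X Y S"
  shows extender_add: "\<lbrakk>lip_real Y X K f; lip_real Y X L g; y \<in> mspace Y\<rbrakk> \<Longrightarrow> S (f + g) y = S f y + S g y"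
    and extender_scaleR: "\<lbrakk>lip_real Y X L f; y \<in> mspace Y\<rbrakk> \<Longrightarrow> S (a *\<^sub>R f) y = a * S f y"
    and extender_eq: "\<lbrakk>lip_real Y X L f; x \<in> X\<rbrakk> \<Longrightarrow> S f x = f x"
    and extender_lip: "\<lbrakk>0 \<le> L; lip_real Y X L f\<rbrakk> \<Longrightarrow> lip_real Y (mspace Y) (c * L) (S f)"
  using assms unfolding lip_extender_def by blast+

lemma lip_extenderI:
  assumes "\<And>f g K L y. \<lbrakk>lip_real Y X K f; lip_real Y X L g; y \<in> mspace Y\<rbrakk> \<Longrightarrow> S (f + g) y = S f y + S g y"
    and "\<And>a f L y. \<lbrakk>lip_real Y X L f; y \<in> mspace Y\<rbrakk> \<Longrightarrow> S (a *\<^sub>R f) y = a * S f y"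
    and "\<And>f L x. \<lbrakk>lip_real Y X L f; x \<in> X\<rbrakk> \<Longrightarrow> S f x = f x"
    and "\<And>f L. \<lbrakk>0 \<le> L; lip_real Y X L f\<rbrakk> \<Longrightarrow> lip_real Y (mspace Y) (c * L) (S f)"
  shows "lip_extender c X Y S"
  unfolding lip_extender_def using assms by (intro conjI allI impI ballI)

lemma lip_extender_mono:
  assumes "lip_extender c X Y S" "c \<le> d"
  shows "lip_extender d X Y S"
proof (rule lip_extenderI)
  show "lip_real Y (mspace Y) (d * L) (S f)" if "0 \<le> L" "lip_real Y X L f" for f L
    using extender_lip[OF assms(1) that] mult_right_mono[OF assms(2) that(1)]
    by (rule lip_real_mono) simp
qed (use extender_add[OF assms(1)] extender_scaleR[OF assms(1)] extender_eq[OF assms(1)] in blast)+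

definition rebase :: "'a \<Rightarrow> 'a set \<Rightarrow> ('a \<Rightarrow> real) \<Rightarrow> 'a \<Rightarrow> real" where
  "rebase p X f = (\<lambda>x. if x \<in> X then f x - f p else 0)"

lemma rebase_add: "rebase p X (f + g) = rebase p X f + rebase p X g"
  and rebase_scaleR: "rebase p X (a *\<^sub>R f) = a *\<^sub>R rebase p X f"
  by (auto simp: rebase_def fun_eq_iff right_diff_distrib)

lemma
  assumes "X \<subseteq> mspace Y" "p \<in> X" "lip_real Y X L f"
  shows rebase_in_Lip0: "rebase p X f \<in> vecs (Lip0 p (submetric Y X))"
    and nrm_rebase_le: "0 \<le> L \<Longrightarrow> nrm (Lip0 p (submetric Y X)) (rebase p X f) \<le> L"
proof -
  have X: "mspace (submetric Y X) = X"
    using assms(1) by auto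
  have lip: "lip_real (submetric Y X) (mspace (submetric Y X)) L (rebase p X f)"
    using assms(3) unfolding X by (simp add: lip_real_def rebase_def)
  show "rebase p X f \<in> vecs (Lip0 p (submetric Y X))"
    by (rule Lip0I[OF lip]) (use assms(2) in \<open>simp_all only: X, simp_all add: rebase_def\<close>)
  show "0 \<le> L \<Longrightarrow> nrm (Lip0 p (submetric Y X)) (rebase p X f) \<le> L"
    using lip by (intro nrm_Lip0_le)
qed

lemma lip_extender_if_linear_ext_op:
  assumes X: "X \<subseteq> mspace Y" and p: "p \<in> X" and T: "linear_ext_op p X Y T"
  shows "lip_extender (op_norm (Lip0 p (submetric Y X)) (Lip0 p Y) T) X Y (\<lambda>f y. T (rebase p X f) y + f p)"
proof -
  let ?A = "Lip0 p (submetric Y X)" and ?B = "Lip0 p Y"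
  have A: "normed_space ?A" and B: "normed_space ?B"
    using p X by (auto intro!: normed_space_Lip0)
  have bounded: "bounded_linear_map ?A ?B T" and ext: "\<And>f x. f \<in> vecs ?A \<Longrightarrow> x \<in> X \<Longrightarrow> T f x = f x"
    using T by (auto simp: linear_ext_op_def)
  then have lin: "linear_map ?A ?B T"
    by (simp add: bounded_linear_map_def)
  note mem = rebase_in_Lip0[OF X p]
  show ?thesis
  proof (rule lip_extenderI)
    fix f L assume "0 \<le> L" and f: "lip_real Y X L f"
    let ?h = "T (rebase p X f)"
    have "nrm ?B ?h \<le> op_norm ?A ?B T * nrm ?A (rebase p X f)"
      by (rule nrm_le_op_norm[OF bounded A B mem[OF f]])
    also have "\<dots> \<le> op_norm ?A ?B T * L"
      using nrm_rebase_le[OF X p f \<open>0 \<le> L\<close>] op_norm_nonneg[OF bounded A B] by (rule mult_left_mono)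
    finally have "lip_real Y (mspace Y) (op_norm ?A ?B T * L) ?h"
      by (rule lip_real_mono[OF lip_real_nrm_Lip0[OF linear_map_in[OF lin mem[OF f]]] _ subset_refl])
    then show "lip_real Y (mspace Y) (op_norm ?A ?B T * L) (\<lambda>y. ?h y + f p)"
      by (simp add: lip_real_def)
  qed (auto simp: rebase_add rebase_scaleR linear_map_add[OF lin mem mem]
      linear_map_scaleR[OF lin mem] ext[OF mem] distrib_left, simp add: rebase_def)
qed

lemma linear_ext_op_if_lip_extender:
  assumes X: "X \<subseteq> mspace Y" and p: "p \<in> X" and S: "lip_extender c X Y S" and "0 \<le> c"
  obtains T where "linear_ext_op p X Y T" "op_norm (Lip0 p (submetric Y X)) (Lip0 p Y) T \<le> c"
proof -
  let ?A = "Lip0 p (submetric Y X)" and ?B = "Lip0 p Y"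
  have A: "normed_space ?A"
    using p X by (auto intro!: normed_space_Lip0)
  have mX: "mspace (submetric Y X) = X"
    using X by auto
  define T where "T f y = (if y \<in> mspace Y then S f y else 0)" for f y
  have lip: "lip_real Y X (nrm ?A f) f" if "f \<in> vecs ?A" for f
    using lip_real_nrm_Lip0[OF that] unfolding mX by simp
  have T_lip: "lip_real Y (mspace Y) (c * nrm ?A f) (T f)" if "f \<in> vecs ?A" for f
    using extender_lip[OF S nrm_Lip0_nonneg[OF that] lip[OF that]] by (simp add: lip_real_def T_def)
  have T_ext: "T f x = f x" if "f \<in> vecs ?A" "x \<in> X" for f x
    using extender_eq[OF S lip[OF that(1)] that(2)] X that(2) by (auto simp: T_def)
  have le: "nrm ?B (T f) \<le> c * nrm ?A f" if "f \<in> vecs ?A" for f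
    using nrm_Lip0_le[OF _ T_lip[OF that]] nrm_Lip0_nonneg[OF that] \<open>0 \<le> c\<close> by simp
  have "T f \<in> vecs ?B" if "f \<in> vecs ?A" for f
    by (rule Lip0I[OF T_lip[OF that]]) (use T_ext[OF that p] Lip0_base[OF that] in \<open>auto simp: T_def\<close>)
  moreover have "T (f + g) = T f + T g" if "f \<in> vecs ?A" "g \<in> vecs ?A" for f g
    using extender_add[OF S lip[OF that(1)] lip[OF that(2)]] by (auto simp: T_def fun_eq_iff)
  moreover have "T (a *\<^sub>R f) = a *\<^sub>R T f" if "f \<in> vecs ?A" for a f
    using extender_scaleR[OF S lip[OF that]] by (auto simp: T_def fun_eq_iff)
  ultimately have "linear_map ?A ?B T"
    by (auto simp: linear_map_def)
  then have "linear_ext_op p X Y T"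
    using le T_ext by (auto simp: linear_ext_op_def bounded_linear_map_def)
  then show thesis
    using that op_norm_le[OF A \<open>0 \<le> c\<close> le] by blast
qed

text \<open>Passing between operators on \<open>Lip\<^sub>0(X)\<close> and extenders increases norms in neither direction, for any
  basepoint; so the basepoint chosen in the definition of \<open>\<lambda>\<close> is immaterial.\<close>

theorem lambda_Lip_eq_Inf_extender:
  assumes X: "X \<subseteq> mspace Y" "X \<noteq> {}"
  shows "lambda_Lip X Y = Inf {ennreal c | c. 0 \<le> c \<and> (\<exists>S. lip_extender c X Y S)}"
proof -
  define p where "p = (SOME p. p \<in> X)"
  have p: "p \<in> X"
    using X(2) by (auto simp: p_def some_in_eq)
  let ?A = "Lip0 p (submetric Y X)" and ?B = "Lip0 p Y"
  have norms: "normed_space ?A" "normed_space ?B"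
    using p X by (auto intro!: normed_space_Lip0)
  have eq: "lambda_Lip X Y = Inf {ennreal (op_norm ?A ?B T) | T. linear_ext_op p X Y T}"
    by (simp add: lambda_Lip_def p_def Let_def)
  show ?thesis
    unfolding eq
  proof (rule antisym; rule Inf_mono; clarify)
    fix c S assume "0 \<le> c" and S: "lip_extender c X Y S"
    obtain T where "linear_ext_op p X Y T" "op_norm ?A ?B T \<le> c"
      using linear_ext_op_if_lip_extender[OF X(1) p S \<open>0 \<le> c\<close>] .
    then show "\<exists>b\<in>{ennreal (op_norm ?A ?B T) |T. linear_ext_op p X Y T}. b \<le> ennreal c"
      using ennreal_leI by blast
  next
    fix T assume T: "linear_ext_op p X Y T"
    then have "0 \<le> op_norm ?A ?B T"
      using op_norm_nonneg norms by (auto simp: linear_ext_op_def)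
    then show "\<exists>a\<in>{ennreal c |c. 0 \<le> c \<and> (\<exists>S. lip_extender c X Y S)}. a \<le> ennreal (op_norm ?A ?B T)"
      using lip_extender_if_linear_ext_op[OF X(1) p T] by blast
  qed
qed

lemma lambda_Lip_le:
  assumes "X \<subseteq> mspace Y" "X \<noteq> {}" "0 \<le> c" "lip_extender c X Y S"
  shows "lambda_Lip X Y \<le> ennreal c"
  unfolding lambda_Lip_eq_Inf_extender[OF assms(1,2)] using assms(3,4) by (auto intro!: Inf_lower)

lemma lip_extender_if_lambda_Lip_less:
  assumes "X \<subseteq> mspace Y" "X \<noteq> {}" "lambda_Lip X Y < ennreal c"
  obtains S where "lip_extender c X Y S"
proof -
  obtain d S where "ennreal d < ennreal c" "0 \<le> d" "lip_extender d X Y S"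
    using assms(3) unfolding lambda_Lip_eq_Inf_extender[OF assms(1,2)] by (auto simp: Inf_less_iff)
  then show thesis
    using that lip_extender_mono[of d X Y S c] by (simp add: ennreal_less_iff)
qed

text \<open>The function \<open>d(x, \<cdot>)\<close> on \<open>X\<close> is \<open>1\<close>-Lipschitz and has slope \<open>1\<close> between \<open>x\<close> and \<open>z\<close>, so every
  extension of it has at least this slope.\<close>

lemma one_le_lambda_Lip:
  assumes X: "X \<subseteq> mspace Y" and xz: "x \<in> X" "z \<in> X" "x \<noteq> z"
  shows "1 \<le> lambda_Lip X Y"
proof -
  have ne: "X \<noteq> {}"
    using xz by auto
  have pos: "mdist Y x z > 0"
    using xz X mdist_nonneg[of Y x z] mdist_zero[of x Y z] by (metis less_le subsetD)
  have dist: "lip_real Y X 1 (mdist Y x)"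
    unfolding lip_real_def
  proof (intro ballI)
    fix u v assume "u \<in> X" "v \<in> X"
    then have "u \<in> mspace Y" "v \<in> mspace Y" "x \<in> mspace Y"
      using X xz by auto
    then show "\<bar>mdist Y x u - mdist Y x v\<bar> \<le> 1 * mdist Y u v"
      using mdist_triangle[of x Y u v] mdist_triangle[of x Y v u] mdist_commute[of Y u v] by simp
  qed
  have "1 \<le> ennreal c" if "0 \<le> c" and S: "lip_extender c X Y S" for c S
  proof -
    have "lip_real Y X (c * 1) (S (mdist Y x))"
      by (rule lip_real_mono[OF extender_lip[OF S zero_le_one dist] order_refl X])
    then have "\<bar>mdist Y x x - mdist Y x z\<bar> \<le> c * mdist Y x z"
      using lip_realD[of Y X "c * 1" _ x z] extender_eq[OF S dist] xz by fastforce
    then have "1 * mdist Y x z \<le> c * mdist Y x z"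
      using X xz by (simp add: subsetD)
    with pos have "1 \<le> c"
      by (rule_tac mult_right_le_imp_le)
    then show ?thesis
      by simp
  qed
  then show ?thesis
    unfolding lambda_Lip_eq_Inf_extender[OF X ne] by (auto intro!: Inf_greatest)
qed


section \<open>Compactness\<close>

text \<open>The values at a given function and point of the extenders for finite sets containing \<open>p\<close> stay in
  a compact interval, so these extenders, indexed by the directed set of finite subsets, have a
  cluster point in a product of compact intervals. Being an extender is a conjunction of closed
  conditions on finitely many coordinates each, and passes to the cluster point.\<close>

theorem lip_extender_compactness:
  assumes X: "X \<subseteq> mspace Y" "X \<noteq> {}" and "0 \<le> c"
    and fin: "\<And>F. \<lbrakk>finite F; F \<noteq> {}; F \<subseteq> X\<rbrakk> \<Longrightarrow> \<exists>S. lip_extender c F Y S"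
  obtains S where "lip_extender c X Y S"
proof -
  obtain p where p: "p \<in> X"
    using X(2) by auto
  obtain R where R: "\<And>F. \<lbrakk>finite F; F \<noteq> {}; F \<subseteq> X\<rbrakk> \<Longrightarrow> lip_extender c F Y (R F)"
    using fin by metis
  \<comment> \<open>Coordinates are pairs of a function and a point; only the good ones carry information.\<close>
  define good where "good = {(f, y). (\<exists>L. lip_real Y X L f) \<and> y \<in> mspace Y}"
  \<comment> \<open>One Lipschitz constant per function, so that the intervals below are well defined.\<close>
  define lc where "lc f = \<bar>SOME L. lip_real Y X L f\<bar>" for f
  have lc: "lip_real Y X (lc f) f" if "lip_real Y X L f" for f L
    unfolding lc_def using lip_real_abs someI_ex[of "\<lambda>L. lip_real Y X L f"] that by blast
  define I where "I i = (if i \<in> good then cball (fst i p) (c * lc (fst i) * mdist Y (snd i) p) else {0})" for i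
  define \<sigma> where "\<sigma> F i = (if i \<in> good then R F (fst i) (snd i) else 0)" for F i
  let ?N = "finite_subsets_at_top X"
  have "compactin (product_topology (\<lambda>_. euclidean) UNIV) (PiE UNIV I)"
    unfolding compactin_PiE by (simp add: I_def)
  then have compact: "compact (PiE UNIV I)"
    by (simp add: euclidean_product_topology)
  have large: "\<forall>\<^sub>F F in ?N. finite F \<and> A \<subseteq> F \<and> F \<subseteq> X" if "finite A" "A \<subseteq> X" for A
    using that by (auto simp: eventually_finite_subsets_at_top)
  have ext: "lip_extender c F Y (R F)" if "finite F \<and> {p} \<subseteq> F \<and> F \<subseteq> X" for F
    using R[of F] that by auto
  have restrict: "lip_real Y F L f" if "lip_real Y X L f" "finite F \<and> A \<subseteq> F \<and> F \<subseteq> X" for f L F A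
    using that by (auto intro: lip_real_mono)
  have "\<sigma> F i \<in> I i" if F: "finite F \<and> {p} \<subseteq> F \<and> F \<subseteq> X" for F i
  proof (cases "i \<in> good")
    case True
    then obtain f y L where i: "i = (f, y)" "lip_real Y X L f" "y \<in> mspace Y"
      by (auto simp: good_def)
    have f: "lip_real Y F (lc f) f"
      using restrict[OF lc[OF i(2)] F] .
    have "\<bar>R F f y - R F f p\<bar> \<le> c * lc f * mdist Y y p"
      using extender_lip[OF ext[OF F] _ f] i(3) p X(1) by (auto simp: lip_real_def lc_def)
    moreover have "R F f p = f p"
      using extender_eq[OF ext[OF F] f] F by auto
    ultimately show ?thesis
      using True by (simp add: \<sigma>_def I_def i(1) dist_real_def abs_minus_commute)
  qed (simp add: \<sigma>_def I_def)
  then have "\<forall>\<^sub>F F in ?N. \<sigma> F \<in> PiE UNIV I"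
    using large[of "{p}"] p by (auto elim: eventually_mono)
  then have "\<forall>\<^sub>F t in filtermap \<sigma> ?N. t \<in> PiE UNIV I"
    by (simp only: eventually_filtermap)
  moreover have "filtermap \<sigma> ?N \<noteq> bot"
    by (simp add: filtermap_bot_iff)
  \<comment> \<open>A cluster point, and a finer filter that converges to it.\<close>
  ultimately obtain s where s: "inf (nhds s) (filtermap \<sigma> ?N) \<noteq> bot"
    using compact unfolding compact_filter by blast
  define G where "G = inf (nhds s) (filtermap \<sigma> ?N)"
  have G_bot: "G \<noteq> bot"
    using s by (simp add: G_def)
  have lim: "((\<lambda>t. t i) \<longlongrightarrow> s i) G" for i
  proof -
    have "((\<lambda>t. t i) \<longlongrightarrow> s i) (at s)"
      using continuous_on_product_coordinates[of i] unfolding continuous_on_def by blast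
    then have "((\<lambda>t. t i) \<longlongrightarrow> s i) (nhds s)"
      by (rule tendsto_at_iff_tendsto_nhds[THEN iffD1])
    then show ?thesis
      unfolding G_def by (rule tendsto_mono[rotated]) simp
  qed
  have ev: "\<forall>\<^sub>F t in G. P t"
    if "finite A" "A \<subseteq> X" "\<And>F. finite F \<and> A \<subseteq> F \<and> F \<subseteq> X \<Longrightarrow> P (\<sigma> F)" for P A
  proof -
    have "\<forall>\<^sub>F t in filtermap \<sigma> ?N. P t"
      unfolding eventually_filtermap using large[OF that(1,2)] that(3) by (rule eventually_mono)
    then show ?thesis
      unfolding G_def by (rule filter_leD[rotated]) simp
  qed
  have "lip_extender c X Y (\<lambda>f y. s (f, y))"
  proof (rule lip_extenderI)
    fix f g K L y assume f: "lip_real Y X K f" and g: "lip_real Y X L g" and y: "y \<in> mspace Y"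
    have good: "(f + g, y) \<in> good" "(f, y) \<in> good" "(g, y) \<in> good"
      using f g lip_real_add[OF f g] y by (auto simp: good_def)
    have "\<forall>\<^sub>F t in G. t (f + g, y) = t (f, y) + t (g, y)"
      using p f g y good extender_add[OF ext restrict[OF f] restrict[OF g]]
      by (intro ev[of "{p}"]) (auto simp: \<sigma>_def)
    then have "((\<lambda>t. t (f, y) + t (g, y)) \<longlongrightarrow> s (f + g, y)) G"
      using lim[of "(f + g, y)"] by (rule Lim_transform_eventually[rotated])
    then show "s (f + g, y) = s (f, y) + s (g, y)"
      using tendsto_unique[OF G_bot] tendsto_add[OF lim lim] by blast
  next
    fix a f L y assume f: "lip_real Y X L f" and y: "y \<in> mspace Y"
    have good: "(a *\<^sub>R f, y) \<in> good" "(f, y) \<in> good"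
      using f lip_real_scaleR[OF f] y by (auto simp: good_def)
    have "\<forall>\<^sub>F t in G. t (a *\<^sub>R f, y) = a * t (f, y)"
      using p y good extender_scaleR[OF ext restrict[OF f]]
      by (intro ev[of "{p}"]) (auto simp: \<sigma>_def)
    then have "((\<lambda>t. a * t (f, y)) \<longlongrightarrow> s (a *\<^sub>R f, y)) G"
      using lim[of "(a *\<^sub>R f, y)"] by (rule Lim_transform_eventually[rotated])
    then show "s (a *\<^sub>R f, y) = a * s (f, y)"
      using tendsto_unique[OF G_bot] tendsto_mult_left[OF lim] by blast
  next
    fix f L x assume f: "lip_real Y X L f" and x: "x \<in> X"
    then have good: "(f, x) \<in> good"
      using X(1) by (auto simp: good_def)
    have "\<forall>\<^sub>F t in G. t (f, x) = f x"
      using p x good extender_eq[OF ext restrict[OF f]]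
      by (intro ev[of "{p, x}"]) (auto simp: \<sigma>_def)
    then have "((\<lambda>_. f x) \<longlongrightarrow> s (f, x)) G"
      using lim[of "(f, x)"] by (rule Lim_transform_eventually[rotated])
    then show "s (f, x) = f x"
      using tendsto_unique[OF G_bot] tendsto_const by blast
  next
    fix f L assume L: "0 \<le> L" and f: "lip_real Y X L f"
    show "lip_real Y (mspace Y) (c * L) (\<lambda>y. s (f, y))"
      unfolding lip_real_def
    proof (intro ballI)
      fix y z assume yz: "y \<in> mspace Y" "z \<in> mspace Y"
      then have good: "(f, y) \<in> good" "(f, z) \<in> good"
        using f by (auto simp: good_def)
      have "\<forall>\<^sub>F t in G. \<bar>t (f, y) - t (f, z)\<bar> \<le> c * L * mdist Y y z"
        using p yz good lip_realD[OF extender_lip[OF ext L restrict[OF f]]]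
        by (intro ev[of "{p}"]) (auto simp: \<sigma>_def)
      then show "\<bar>s (f, y) - s (f, z)\<bar> \<le> c * L * mdist Y y z"
        by (rule tendsto_upperbound[OF tendsto_rabs[OF tendsto_diff[OF lim lim]] _ G_bot])
    qed
  qed
  then show thesis
    by (rule that)
qed

theorem lambda_Lip_le_SUP_finite:
  assumes X: "X \<subseteq> mspace Y" "X \<noteq> {}"
  shows "lambda_Lip X Y \<le> (SUP F\<in>{F. finite F \<and> F \<noteq> {} \<and> F \<subseteq> X}. lambda_Lip F Y)" (is "_ \<le> ?s")
proof (rule ennreal_le_epsilon)
  fix e :: real assume e: "?s < top" "0 < e"
  then obtain r where r: "0 \<le> r" "?s = ennreal r"
    by (cases ?s) auto
  obtain S where "lip_extender (r + e) X Y S"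
  proof (rule lip_extender_compactness[OF X])
    show "0 \<le> r + e"
      using r(1) e(2) by simp
    fix F assume F: "finite F" "F \<noteq> {}" "F \<subseteq> X"
    have "lambda_Lip F Y \<le> ?s"
      using F by (intro SUP_upper) simp
    also have "\<dots> < ennreal (r + e)"
      using r e(2) by (simp add: ennreal_less_iff)
    finally show "\<exists>S. lip_extender (r + e) F Y S"
      using lip_extender_if_lambda_Lip_less[OF _ F(2)] F(3) X(1) by (metis subset_trans)
  qed
  then have "lambda_Lip X Y \<le> ennreal (r + e)"
    using r(1) e(2) by (intro lambda_Lip_le[OF X]) auto
  then show "lambda_Lip X Y \<le> ?s + ennreal e"
    using r e(2) by (simp add: ennreal_plus)
qed


section \<open>Extension of maps into dual spaces\<close>

text \<open>A map into a dual space is a family of real functions, one for each vector of the predual, that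
  depends linearly on this vector; extending every member by the same linear operator keeps the
  family linear.\<close>

lemma extend_into_dual:
  assumes Z: "normed_space Z" and X: "X \<subseteq> mspace Y" "X \<noteq> {}" and S: "lip_extender c X Y S" and "0 \<le> c"
    and f: "lipschitz_map L (submetric Y X) (norm_metric (dual_of Z)) f" and "0 \<le> L"
  obtains g where "lipschitz_map (c * L) Y (norm_metric (dual_of Z)) g" "\<And>x. x \<in> X \<Longrightarrow> g x = f x"
proof -
  let ?D = "dual_of Z"
  have D: "normed_space ?D"
    by (rule normed_space_dual_of[OF Z])
  have fD: "f x \<in> vecs ?D" if "x \<in> X" for x
    using f that X(1) by (auto simp: lipschitz_map_def mspace_norm_metric[OF D])
  have f_lip: "nrm ?D (f x - f x') \<le> L * mdist Y x x'" if "x \<in> X" "x' \<in> X" for x x'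
    using f that X(1) fD by (auto simp: lipschitz_map_def mdist_norm_metric[OF D] subset_iff)
  define a where "a z x = (if x \<in> X then f x z else 0)" for z x
  have a_lip: "lip_real Y X (L * nrm Z z) (a z)" if z: "z \<in> vecs Z" for z
    unfolding lip_real_def
  proof (intro ballI)
    fix x x' assume x: "x \<in> X" "x' \<in> X"
    have "\<bar>(f x - f x') z\<bar> \<le> nrm ?D (f x - f x') * nrm Z z"
      by (intro abs_dual_le[OF Z _ z] vecs_diff[OF D] fD x)
    also have "\<dots> \<le> L * mdist Y x x' * nrm Z z"
      by (intro mult_right_mono f_lip x nrm_nonneg[OF Z z])
    finally show "\<bar>a z x - a z x'\<bar> \<le> L * nrm Z z * mdist Y x x'"
      using x by (simp add: a_def mult_ac)
  qed
  have a_add: "a (z + z') = a z + a z'" if "z \<in> vecs Z" "z' \<in> vecs Z" for z z'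
    using that by (auto simp: a_def fun_eq_iff dual_add[OF fD])
  have a_scale: "a (r *\<^sub>R z) = r *\<^sub>R a z" if "z \<in> vecs Z" for r z
    using that by (auto simp: a_def fun_eq_iff dual_scaleR[OF fD])
  have Sa_lip: "\<bar>S (a z) y - S (a z) y'\<bar> \<le> c * L * mdist Y y y' * nrm Z z"
    if z: "z \<in> vecs Z" and y: "y \<in> mspace Y" "y' \<in> mspace Y" for z y y'
    using lip_realD[OF extender_lip[OF S _ a_lip[OF z]] y] nrm_nonneg[OF Z z] \<open>0 \<le> L\<close>
    by (simp add: mult_ac)
  obtain p where p: "p \<in> X"
    using X(2) by auto
  define g where "g y z = (if z \<in> vecs Z then S (a z) y else 0)" for y z
  have gD: "g y \<in> vecs ?D" if y: "y \<in> mspace Y" for y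
  proof (rule dual_ofI)
    show "g y (z + z') = g y z + g y z'" if "z \<in> vecs Z" "z' \<in> vecs Z" for z z'
      using that extender_add[OF S a_lip a_lip y] by (simp add: g_def a_add vecs_add[OF Z])
    show "g y (r *\<^sub>R z) = r * g y z" if "z \<in> vecs Z" for r z
      using that extender_scaleR[OF S a_lip y] by (simp add: g_def a_scale vecs_scaleR[OF Z])
    show "g y z = 0" if "z \<notin> vecs Z" for z
      using that by (simp add: g_def)
    show "\<bar>g y z\<bar> \<le> (nrm ?D (f p) + c * L * mdist Y y p) * nrm Z z" if z: "z \<in> vecs Z" for z
      using Sa_lip[OF z y, of p] extender_eq[OF S a_lip[OF z] p] abs_dual_le[OF Z fD[OF p] z] p X(1)
      by (auto simp: g_def a_def z distrib_right)
  qed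
  have "nrm ?D (g y - g y') \<le> c * L * mdist Y y y'" if y: "y \<in> mspace Y" "y' \<in> mspace Y" for y y'
  proof (rule nrm_dual_le[OF Z])
    show "0 \<le> c * L * mdist Y y y'"
      using \<open>0 \<le> c\<close> \<open>0 \<le> L\<close> by simp
    show "\<bar>(g y - g y') z\<bar> \<le> c * L * mdist Y y y' * nrm Z z" if "z \<in> vecs Z" for z
      using Sa_lip[OF that y] that by (simp add: g_def)
  qed
  then have "lipschitz_map (c * L) Y (norm_metric ?D) g"
    using gD by (simp add: lipschitz_map_def mspace_norm_metric[OF D] mdist_norm_metric[OF D])
  moreover have "g x = f x" if "x \<in> X" for x
  proof
    fix z
    show "g x z = f x z"
      using extender_eq[OF S a_lip that, of z] dual_outside[OF fD[OF that], of z] that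
      by (simp add: g_def a_def)
  qed
  ultimately show thesis
    by (rule that)
qed

text \<open>A dual space is isometric to a space to which \<open>extend_into_dual\<close> applies directly, without a
  detour through the bidual.\<close>

lemma ext_const_le_lambda_Lip_if_dual:
  fixes E :: "'v::real_vector nvs"
  assumes "dual_banach_space E" and X: "X \<subseteq> mspace Y" "X \<noteq> {}"
    and f: "Lipschitz_continuous_map (submetric Y X) (norm_metric E) f"
  shows "ext_const X Y E f \<le> lambda_Lip X Y"
  unfolding lambda_Lip_eq_Inf_extender[OF X]
proof (rule Inf_greatest, clarify)
  let ?L = "Lip (submetric Y X) (norm_metric E) f"
  fix c S assume "0 \<le> c" and S: "lip_extender c X Y S"
  obtain Z :: "('v \<Rightarrow> real) nvs" where "banach_space Z" and iso: "isometrically_isomorphic (dual_of Z) E"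
    using assms(1) by (auto simp: dual_banach_space_def)
  then have Z: "normed_space Z" and D: "normed_space (dual_of Z)" and E: "normed_space E"
    using assms(1) by (auto simp: dual_banach_space_def banach_space_def intro: normed_space_dual_of)
  obtain T R where T: "linear_map (dual_of Z) E T" and R: "linear_map E (dual_of Z) R"
    and TR: "\<And>y. y \<in> vecs E \<Longrightarrow> T (R y) = y"
    and T_iso: "\<And>x. x \<in> vecs (dual_of Z) \<Longrightarrow> nrm E (T x) = nrm (dual_of Z) x"
    and R_iso: "\<And>y. y \<in> vecs E \<Longrightarrow> nrm (dual_of Z) (R y) = nrm E y"
    using isometrically_isomorphicE[OF iso D] by metis
  have Rf: "lipschitz_map ?L (submetric Y X) (norm_metric (dual_of Z)) (R \<circ> f)"
    using lipschitz_map_compose[OF lipschitz_map_Lip[OF f] lipschitz_map_isometry[OF E D R R_iso]] by simp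
  obtain g where g: "lipschitz_map (c * ?L) Y (norm_metric (dual_of Z)) g" "\<And>x. x \<in> X \<Longrightarrow> g x = (R \<circ> f) x"
    using extend_into_dual[OF Z X S \<open>0 \<le> c\<close> Rf Lip_nonneg[OF f]] by blast
  have "lipschitz_map (c * ?L) Y (norm_metric E) (T \<circ> g)"
    using lipschitz_map_compose[OF g(1) lipschitz_map_isometry[OF D E T T_iso]] by simp
  moreover have "(T \<circ> g) x = f x" if "x \<in> X" for x
  proof -
    have "f x \<in> vecs E"
      using Lipschitz_continuous_map_image[OF f] that X(1) by (auto simp: mspace_norm_metric[OF E])
    then show ?thesis
      using g(2)[OF that] TR by simp
  qed
  ultimately have "\<exists>h. lipschitz_map (c * ?L) Y (norm_metric E) h \<and> (\<forall>x\<in>X. h x = f x)"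
    by auto
  with \<open>0 \<le> c\<close> show "ext_const X Y E f \<le> ennreal c"
    unfolding ext_const_def by (intro Inf_lower) auto
qed


section \<open>The constant of the bidual\<close>

text \<open>Copies of a space of functions are needed among the functions on functionals. Evaluation at
  arbitrary \<open>h\<close> would not be linear in \<open>G\<close>; the linear \<open>h\<close> suffice to separate points since they
  include the evaluations at single arguments.\<close>

definition functional_embedding :: "('b \<Rightarrow> real) \<Rightarrow> (('b \<Rightarrow> real) \<Rightarrow> real) \<Rightarrow> real" where
  "functional_embedding G = (\<lambda>h. if linear h then h G else 0)"

lemma functional_embedding_add: "functional_embedding (G + H) = functional_embedding G + functional_embedding H"
  and functional_embedding_scaleR: "functional_embedding (a *\<^sub>R G) = a *\<^sub>R functional_embedding G"
  by (auto simp: functional_embedding_def fun_eq_iff linear_add linear_scale)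

lemma inj_functional_embedding: "inj functional_embedding"
proof (rule injI, rule ext)
  fix G H :: "'b \<Rightarrow> real" and x assume eq: "functional_embedding G = functional_embedding H"
  have "linear (\<lambda>G :: 'b \<Rightarrow> real. G x)"
    by (rule linearI) simp_all
  then show "G x = H x"
    using fun_cong[OF eq, of "\<lambda>G. G x"] by (simp add: functional_embedding_def)
qed

text \<open>The lower bounds exclude products of \<open>0\<close> and \<open>\<infinity>\<close>: if \<open>Inf A = 0\<close> is not attained and
  \<open>B = {\<infinity>}\<close>, then \<open>x \<le> a * b\<close> always holds while \<open>Inf A * Inf B = 0\<close>.\<close>

lemma ennreal_le_Inf_mult_Inf:
  fixes A B :: "ennreal set"
  assumes le: "\<And>a b. \<lbrakk>a \<in> A; b \<in> B\<rbrakk> \<Longrightarrow> x \<le> a * b" and "1 \<le> Inf A" "1 \<le> Inf B"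
  shows "x \<le> Inf A * Inf B"
proof -
  have div: "x \<le> Inf C * b" if "\<And>a. a \<in> C \<Longrightarrow> x \<le> a * b" "1 \<le> Inf C" "1 \<le> b" for C and b :: ennreal
  proof (cases "b = top")
    case True
    have "Inf C \<noteq> 0"
      using that(2) by auto
    then show ?thesis
      using True by (simp add: ennreal_mult_top)
  next
    case False
    have "0 < b"
      using that(3) by (meson less_le_trans zero_less_one)
    have "x / b \<le> Inf C"
      using that(1) \<open>0 < b\<close>
      by (intro Inf_greatest divide_le_posI_ennreal) (simp_all add: mult.commute)
    then have "x / b * b \<le> Inf C * b"
      by (rule mult_right_mono) simp
    then show ?thesis
      using False \<open>0 < b\<close> ennreal_divide_self[of b] by (simp add: ennreal_divide_times top.not_eq_extremum)
  qed
  have "x \<le> Inf A * b" if "b \<in> B" for b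
    using that le assms(2,3) by (intro div) (auto intro: order_trans[OF _ Inf_lower])
  then have "x \<le> Inf B * Inf A"
    using assms(2,3) by (intro div) (auto simp: mult.commute)
  then show ?thesis
    by (simp add: mult.commute)
qed

text \<open>Extend first into the bidual, where extension is governed by linear extension operators, then
  map the bidual back by an extension of the identity of \<open>E\<close>. For the definition of \<open>\<nu>(E, E\<^sup>*\<^sup>*)\<close> to
  see this identity, the target must be replaced by a copy of \<open>E\<close> in the universe of Banach spaces.
  The degenerate products of \<open>0\<close> and \<open>\<infinity>\<close> do not occur, since both factors are at least \<open>1\<close> unless
  the map to be extended is constant.\<close>

lemma ext_const_le_K_const_mult_lambda_Lip:
  fixes E :: "'v::real_vector nvs"
  assumes banach: "banach_space E" and "E \<in> \<B>" and X: "X \<subseteq> mspace Y" "X \<noteq> {}"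
    and f: "Lipschitz_continuous_map (submetric Y X) (norm_metric E) f"
  shows "ext_const X Y E f \<le> K_const TYPE('u::real_vector) \<B> * lambda_Lip X Y"
proof -
  let ?L = "Lip (submetric Y X) (norm_metric E) f"
  have E: "normed_space E"
    using banach by (rule normed_space_if_banach_space)
  have fE: "f x \<in> vecs E" if "x \<in> X" for x
    using Lipschitz_continuous_map_image[OF f] that X(1) by (auto simp: mspace_norm_metric[OF E])
  have f_lip: "nrm E (f x - f x') \<le> ?L * mdist Y x x'" if "x \<in> X" "x' \<in> X" for x x'
    using lipschitz_map_Lip[OF f] that X(1) fE
    by (auto simp: lipschitz_map_def mdist_norm_metric[OF E] subset_iff)
  obtain p where p: "p \<in> X"
    using X(2) by auto
  have pos_if: "\<exists>x\<in>X. f x \<noteq> f p" if "?L \<noteq> 0"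
  proof (rule ccontr)
    assume "\<not> (\<exists>x\<in>X. f x \<noteq> f p)"
    then have "lipschitz_map 0 (submetric Y X) (norm_metric E) f"
      using fE by (auto simp: lipschitz_map_def mspace_norm_metric[OF E] mdist_norm_metric[OF E] nrm_0[OF E])
    then show False
      using Lip_le[OF order_refl] Lip_nonneg[OF f] that by fastforce
  qed
  show ?thesis
  proof (cases "?L = 0")
    case True
    have "f x = f p" if "x \<in> X" for x
      using f_lip[OF that p] True nrm_nonneg[OF E vecs_diff[OF E fE fE], OF that p]
        nrm_eq_0_iff[OF E vecs_diff[OF E fE fE], OF that p] by simp
    moreover have "lipschitz_map (0 * ?L) Y (norm_metric E) (\<lambda>_. f p)"
      using fE[OF p] by (simp add: lipschitz_map_def mspace_norm_metric[OF E] mdist_norm_metric[OF E] nrm_0[OF E])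
    ultimately have "\<exists>g. lipschitz_map (0 * ?L) Y (norm_metric E) g \<and> (\<forall>x\<in>X. g x = f x)"
      by (intro exI[of _ "\<lambda>_. f p"]) auto
    then have "ext_const X Y E f \<le> ennreal 0"
      unfolding ext_const_def by (intro Inf_lower) blast
    then show ?thesis
      by simp
  next
    case False
    then obtain q where q: "q \<in> X" "f q \<noteq> f p"
      using pos_if by auto
    let ?J = "bidual_embedding E" and ?DD = "dual_of (dual_of E)"
    have D: "normed_space (dual_of E)" and DD: "normed_space ?DD"
      using E by (auto intro!: normed_space_dual_of)
    have J: "linear_map E ?DD ?J" and J_iso: "\<And>x. x \<in> vecs E \<Longrightarrow> nrm ?DD (?J x) = nrm E x"
      using linear_map_bidual_embedding[OF E] nrm_bidual_embedding[OF E] by auto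
    have J_inj: "inj_on ?J (vecs E)"
      by (rule isometry_inj_on[OF E DD J J_iso])
    \<comment> \<open>\<open>E'\<close> is the copy of \<open>E\<close> and \<open>emb\<close> plays the role of the identity of \<open>E\<close>.\<close>
    define emb where "emb \<Psi> = (functional_embedding \<Psi>, 0 :: 'u)" for \<Psi> :: "('v \<Rightarrow> real) \<Rightarrow> real"
    define \<iota> where "\<iota> x = emb (?J x)" for x
    define E' where "E' = nvs_image \<iota> E"
    have \<iota>: "\<iota> (x + y) = \<iota> x + \<iota> y" "\<iota> (c *\<^sub>R x) = c *\<^sub>R \<iota> x" if "x \<in> vecs E" "y \<in> vecs E" for c x y
      using that by (simp_all add: \<iota>_def emb_def linear_map_add[OF J] linear_map_scaleR[OF J]
          functional_embedding_add functional_embedding_scaleR)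
    have \<iota>_inj: "inj_on \<iota> (vecs E)"
      using J_inj inj_functional_embedding by (auto simp: inj_on_def \<iota>_def emb_def)
    have E': "normed_space E'" and \<iota>_lin: "linear_map E E' \<iota>" and iso: "isometrically_isomorphic E E'"
      using normed_space_nvs_image[OF E \<iota>_inj \<iota>] linear_map_nvs_image[OF E \<iota>_inj \<iota>]
        isometrically_isomorphic_nvs_image[OF E \<iota>_inj \<iota>] by (auto simp: E'_def)
    have \<iota>_iso: "nrm E' (\<iota> x) = nrm E x" if "x \<in> vecs E" for x
      using that \<iota>_inj by (simp add: E'_def nvs_image_def)
    have "banach_space E'"
      by (rule banach_space_isometric[OF iso banach E'])
    let ?Y = "norm_metric ?DD" and ?X = "?J ` vecs E"
    have JX: "?X \<subseteq> mspace ?Y"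
      using linear_map_in[OF J] by (auto simp: mspace_norm_metric[OF DD])
    have emb_iso: "mdist (norm_metric E') (emb (?J x)) (emb (?J y)) = nrm E (x - y)"
      "mdist ?Y (?J x) (?J y) = nrm E (x - y)" if "x \<in> vecs E" "y \<in> vecs E" for x y
      using that \<iota>_iso[OF vecs_diff[OF E that]] linear_map_diff[OF \<iota>_lin E that] linear_map_in[OF \<iota>_lin]
        J_iso[OF vecs_diff[OF E that]] linear_map_diff[OF J E that] linear_map_in[OF J]
      by (simp_all add: mdist_norm_metric[OF E'] mdist_norm_metric[OF DD] flip: \<iota>_def)
    have emb_lip: "lipschitz_map 1 (submetric ?Y ?X) (norm_metric E') emb"
      using emb_iso linear_map_in[OF \<iota>_lin]
      by (auto simp: lipschitz_map_def mspace_norm_metric[OF E'] simp flip: \<iota>_def)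
    then have emb_cont: "Lipschitz_continuous_map (submetric ?Y ?X) (norm_metric E') emb"
      by (rule Lipschitz_continuous_map_if_lipschitz_map)
    let ?M = "Lip (submetric ?Y ?X) (norm_metric E') emb"
    have M: "0 \<le> ?M" "?M \<le> 1"
      using Lip_nonneg[OF emb_cont] Lip_le[OF zero_le_one emb_lip] by auto
    have "0 < nrm E (f q - f p)"
      using q p fE nrm_nonneg[OF E vecs_diff[OF E fE fE], OF q(1) p]
        nrm_eq_0_iff[OF E vecs_diff[OF E fE fE], OF q(1) p] by simp
    moreover have "nrm E (f q - f p) \<le> ?M * nrm E (f q - f p)"
    proof -
      have mem: "?J (f x) \<in> mspace (submetric ?Y ?X)" if "x \<in> X" for x
        using fE[OF that] JX by auto
      have "mdist (norm_metric E') (emb (?J (f q))) (emb (?J (f p))) \<le> ?M * mdist ?Y (?J (f q)) (?J (f p))"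
        using lipschitz_map_Lip[OF emb_cont] mem[OF q(1)] mem[OF p]
        unfolding lipschitz_map_def by (metis mdist_submetric)
      then show ?thesis
        by (simp add: emb_iso fE p q(1))
    qed
    ultimately have M_pos: "0 < ?M"
      using M(1) by (cases "?M = 0") auto
    have prod: "ext_const X Y E f \<le> ennreal k * ennreal c"
      if k: "0 \<le> k" and r: "lipschitz_map (k * ?M) ?Y (norm_metric E') r" and r_ext: "\<And>\<Psi>. \<Psi> \<in> ?X \<Longrightarrow> r \<Psi> = emb \<Psi>"
        and c: "0 \<le> c" and S: "lip_extender c X Y S" for k r c S
    proof -
      have Jf: "lipschitz_map ?L (submetric Y X) ?Y (?J \<circ> f)"
        using lipschitz_map_compose[OF lipschitz_map_Lip[OF f] lipschitz_map_isometry[OF E DD J J_iso]] by simp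
      obtain g where g: "lipschitz_map (c * ?L) Y ?Y g" "\<And>x. x \<in> X \<Longrightarrow> g x = (?J \<circ> f) x"
        using extend_into_dual[OF D X S c Jf Lip_nonneg[OF f]] by blast
      obtain T where T: "linear_map E' E T" "\<And>x. x \<in> vecs E \<Longrightarrow> T (\<iota> x) = x"
        "\<And>y. y \<in> vecs E' \<Longrightarrow> nrm E (T y) = nrm E' y"
      proof
        show "linear_map E' E (inv_into (vecs E) \<iota>)"
          unfolding linear_map_def
          using \<iota>_inj by (auto simp: E'_def vecs_add[OF E] vecs_scaleR[OF E] simp flip: \<iota>)
        show "inv_into (vecs E) \<iota> (\<iota> x) = x" if "x \<in> vecs E" for x
          using that \<iota>_inj by simp
        show "nrm E (inv_into (vecs E) \<iota> y) = nrm E' y" for y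
          by (simp add: E'_def nvs_image_def)
      qed
      have "lipschitz_map k ?Y (norm_metric E') r"
        using r by (rule lipschitz_map_mono) (use k M in \<open>simp add: mult_left_le\<close>)
      then have "lipschitz_map k ?Y (norm_metric E) (T \<circ> r)"
        using lipschitz_map_compose[OF _ lipschitz_map_isometry[OF E' E T(1,3)]] by fastforce
      then have "lipschitz_map (k * (c * ?L)) Y (norm_metric E) (T \<circ> r \<circ> g)"
        by (rule lipschitz_map_compose[OF g(1)]) (use k in simp)
      moreover have "(T \<circ> r \<circ> g) x = f x" if "x \<in> X" for x
        using g(2)[OF that] r_ext T(2) fE[OF that] by (simp flip: \<iota>_def)
      ultimately have "\<exists>h. lipschitz_map (k * c * ?L) Y (norm_metric E) h \<and> (\<forall>x\<in>X. h x = f x)"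
        by (auto simp: mult.assoc)
      then have "ext_const X Y E f \<le> ennreal (k * c)"
        unfolding ext_const_def using k c by (intro Inf_lower) auto
      then show ?thesis
        using k c by (simp add: ennreal_mult)
    qed
    have "ext_const X Y E f \<le> ext_const ?X ?Y E' emb * lambda_Lip X Y"
      unfolding ext_const_def[of ?X] lambda_Lip_eq_Inf_extender[OF X]
    proof (rule ennreal_le_Inf_mult_Inf)
      show "1 \<le> Inf {ennreal K |K. 0 \<le> K \<and> (\<exists>g. lipschitz_map (K * ?M) ?Y (norm_metric E') g \<and> (\<forall>x\<in>?X. g x = emb x))}"
        using one_le_ext_const[OF emb_cont JX M_pos] by (simp add: ext_const_def)
      have "q \<noteq> p"
        using q by auto
      then show "1 \<le> Inf {ennreal c |c. 0 \<le> c \<and> (\<exists>S. lip_extender c X Y S)}"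
        using one_le_lambda_Lip[OF X(1) q(1) p] lambda_Lip_eq_Inf_extender[OF X] by simp
    qed (use prod in blast)
    also have "ext_const ?X ?Y E' emb \<le> nu TYPE('u) ?X ?Y"
      unfolding nu_def nu_class_def using \<open>banach_space E'\<close> emb_cont
      by (intro SUP_upper2[of E'] SUP_upper) auto
    also have "nu TYPE('u) ?X ?Y \<le> K_const TYPE('u) \<B>"
      unfolding K_const_def using \<open>E \<in> \<B>\<close> by (rule SUP_upper)
    finally show ?thesis
      by (simp add: mult_right_mono)
  qed
qed


section \<open>Extending the evaluation map\<close>

text \<open>An extension of the evaluation map \<open>X \<rightarrow> Lip\<^sub>0(X)\<^sup>*\<close> to \<open>Y\<close> is the same thing as a linear
  extension operator: read \<open>\<langle>g(y), h\<rangle>\<close> as the value at \<open>y\<close> of the extension of \<open>h\<close>.\<close>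

lemma lambda_Lip_le_nu_class:
  assumes X: "X \<subseteq> mspace Y" and p: "p \<in> X" and "E \<in> \<B>" and E: "normed_space E"
    and iso: "isometrically_isomorphic (dual_of (Lip0 p (submetric Y X))) E"
  shows "lambda_Lip X Y \<le> nu_class \<B> X Y"
proof -
  let ?A = "Lip0 p (submetric Y X)"
  have X': "X \<noteq> {}" and mX: "mspace (submetric Y X) = X"
    using p X by auto
  have A: "normed_space ?A"
    using p X by (auto intro!: normed_space_Lip0)
  have D: "normed_space (dual_of ?A)"
    by (rule normed_space_dual_of[OF A])
  obtain T R where T: "linear_map (dual_of ?A) E T" and R: "linear_map E (dual_of ?A) R"
    and RT: "\<And>x. x \<in> vecs (dual_of ?A) \<Longrightarrow> R (T x) = x"
    and T_iso: "\<And>x. x \<in> vecs (dual_of ?A) \<Longrightarrow> nrm E (T x) = nrm (dual_of ?A) x"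
    and R_iso: "\<And>y. y \<in> vecs E \<Longrightarrow> nrm (dual_of ?A) (R y) = nrm E y"
    using isometrically_isomorphicE[OF iso D] by metis
  define \<delta> where "\<delta> x h = (if h \<in> vecs ?A then h x else 0)" for x h
  have A_lip: "\<bar>h x - h x'\<bar> \<le> nrm ?A h * mdist Y x x'" if "h \<in> vecs ?A" "x \<in> X" "x' \<in> X" for h x x'
    using lip_real_nrm_Lip0[OF that(1)] that(2,3) unfolding mX by (simp add: lip_real_def)
  have \<delta>: "\<delta> x \<in> vecs (dual_of ?A)" if "x \<in> X" for x
  proof (rule dual_ofI[where K = "mdist Y x p"])
    show "\<bar>\<delta> x h\<bar> \<le> mdist Y x p * nrm ?A h" if "h \<in> vecs ?A" for h
      using A_lip[OF that \<open>x \<in> X\<close> p] Lip0_base[OF that] that by (simp add: \<delta>_def mult.commute)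
  qed (simp_all add: \<delta>_def vecs_add[OF A] vecs_scaleR[OF A])
  have "nrm (dual_of ?A) (\<delta> x - \<delta> x') \<le> 1 * mdist Y x x'" if "x \<in> X" "x' \<in> X" for x x'
    by (rule nrm_dual_le[OF A]) (use A_lip[OF _ that] in \<open>simp_all add: \<delta>_def mult.commute\<close>)
  then have "lipschitz_map 1 (submetric Y X) (norm_metric (dual_of ?A)) \<delta>"
    using \<delta> by (auto simp: lipschitz_map_def mspace_norm_metric[OF D] mdist_norm_metric[OF D])
  then have T\<delta>: "lipschitz_map 1 (submetric Y X) (norm_metric E) (T \<circ> \<delta>)"
    using lipschitz_map_compose[OF _ lipschitz_map_isometry[OF D E T T_iso]] by fastforce
  then have cont: "Lipschitz_continuous_map (submetric Y X) (norm_metric E) (T \<circ> \<delta>)"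
    by (rule Lipschitz_continuous_map_if_lipschitz_map)
  let ?L = "Lip (submetric Y X) (norm_metric E) (T \<circ> \<delta>)"
  have L: "?L \<le> 1"
    using Lip_le[OF zero_le_one T\<delta>] .
  have "lambda_Lip X Y \<le> ext_const X Y E (T \<circ> \<delta>)"
    unfolding ext_const_def
  proof (rule Inf_greatest, clarify)
    fix K :: real and g
    assume K: "0 \<le> K" and g: "lipschitz_map (K * ?L) Y (norm_metric E) g" and ext: "\<forall>x\<in>X. g x = (T \<circ> \<delta>) x"
    have "lipschitz_map K Y (norm_metric E) g"
      using g by (rule lipschitz_map_mono) (use K L in \<open>simp add: mult_left_le\<close>)
    then have gE: "g y \<in> vecs E" and g_lip: "nrm E (g y - g y') \<le> K * mdist Y y y'"
      if "y \<in> mspace Y" "y' \<in> mspace Y" for y y'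
      using that by (auto simp: lipschitz_map_def mspace_norm_metric[OF E] mdist_norm_metric[OF E] Pi_iff)
    have Rg: "R (g y) \<in> vecs (dual_of ?A)" if "y \<in> mspace Y" for y
      using linear_map_in[OF R gE] that by blast
    have R_lip: "nrm (dual_of ?A) (R (g y) - R (g y')) \<le> K * mdist Y y y'"
      if "y \<in> mspace Y" "y' \<in> mspace Y" for y y'
      using g_lip[OF that] R_iso[OF vecs_diff[OF E gE gE], OF that(1,1,2,2)]
        linear_map_diff[OF R E gE gE, OF that(1,1,2,2)] by simp
    note mem = rebase_in_Lip0[OF X p]
    have "lip_extender K X Y (\<lambda>h y. R (g y) (rebase p X h) + h p)"
    proof (rule lip_extenderI)
      show "R (g x) (rebase p X h) + h p = h x" if h: "lip_real Y X L h" and x: "x \<in> X" for h L x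
        using ext x RT[OF \<delta>[OF x]] mem[OF h] by (simp add: \<delta>_def rebase_def)
      show "lip_real Y (mspace Y) (K * L) (\<lambda>y. R (g y) (rebase p X h) + h p)"
        if L: "0 \<le> L" and h: "lip_real Y X L h" for h L
        unfolding lip_real_def
      proof (intro ballI)
        fix y y' assume y: "y \<in> mspace Y" "y' \<in> mspace Y"
        have "\<bar>(R (g y) - R (g y')) (rebase p X h)\<bar>
            \<le> nrm (dual_of ?A) (R (g y) - R (g y')) * nrm ?A (rebase p X h)"
          by (intro abs_dual_le[OF A _ mem[OF h]] vecs_diff[OF D] Rg y)
        also have "\<dots> \<le> (K * mdist Y y y') * L"
          by (intro mult_mono R_lip y nrm_rebase_le[OF X p h L] nrm_Lip0_nonneg[OF mem[OF h]])
            (use K in simp)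
        finally show "\<bar>R (g y) (rebase p X h) + h p - (R (g y') (rebase p X h) + h p)\<bar> \<le> K * L * mdist Y y y'"
          by (simp add: mult_ac)
      qed
    qed (simp_all add: rebase_add rebase_scaleR dual_add[OF Rg mem mem] dual_scaleR[OF Rg mem] distrib_left)
    then show "lambda_Lip X Y \<le> ennreal K"
      by (rule lambda_Lip_le[OF X X' K])
  qed
  also have "\<dots> \<le> nu_class \<B> X Y"
    unfolding nu_class_def using \<open>E \<in> \<B>\<close> cont by (intro SUP_upper2[of E] SUP_upper) blast+
  finally show ?thesis .
qed

text \<open>Being a dual space requires a predual among the functions on the universe, so \<open>Lip\<^sub>0(X)\<close> needs a
  copy there as well. If \<open>X\<close> is finite, the indicator functions of its points span a space that
  contains \<open>Lip\<^sub>0(X)\<close>.\<close>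

lemma copy_of_dual_Lip0:
  fixes Y :: "'a metric"
  assumes X: "X \<subseteq> mspace Y" and p: "p \<in> X"
  obtains E :: "('a, 'u::real_vector) banach_universe nvs"
    where "dual_banach_space E" "isometrically_isomorphic (dual_of (Lip0 p (submetric Y X))) E"
      "finite X \<Longrightarrow> finite_dimensional E"
proof -
  let ?A = "Lip0 p (submetric Y X)" and ?i = "\<lambda>\<Phi> :: ('a \<Rightarrow> real) \<Rightarrow> real. (\<Phi>, 0 :: 'u)"
  have mX: "mspace (submetric Y X) = X"
    using X by auto
  have banach: "banach_space ?A"
    using p X by (auto intro!: banach_space_Lip0)
  then have A: "normed_space ?A"
    by (rule normed_space_if_banach_space)
  have D: "normed_space (dual_of ?A)"
    by (rule normed_space_dual_of[OF A])
  have i: "linear ?i"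
    by (rule linearI) simp_all
  define E where "E = nvs_image ?i (dual_of ?A)"
  have E: "normed_space E" and E_iso: "isometrically_isomorphic (dual_of ?A) E"
    unfolding E_def
    by (rule normed_space_nvs_image[OF D] isometrically_isomorphic_nvs_image[OF D]; simp add: inj_on_def)+
  have E_banach: "banach_space E"
    by (rule banach_space_isometric[OF E_iso banach_space_dual_of[OF A] E])
  define h where "h f = (\<lambda>(\<Phi>, u :: 'u). functional_embedding f \<Phi>)" for f :: "'a \<Rightarrow> real"
  define Z where "Z = nvs_image h ?A"
  have h_inj: "inj h"
  proof (rule injI)
    fix f g assume eq: "h f = h g"
    have "functional_embedding f = functional_embedding g"
      using fun_cong[OF eq, of "(_, 0)"] by (auto simp: h_def)
    then show "f = g"
      by (rule injD[OF inj_functional_embedding])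
  qed
  have h: "h (f + g) = h f + h g" "h (c *\<^sub>R f) = c *\<^sub>R h f" for f g c
    by (auto simp: h_def fun_eq_iff functional_embedding_add functional_embedding_scaleR)
  have Z: "normed_space Z" and Z_iso: "isometrically_isomorphic ?A Z"
    unfolding Z_def
    by (rule normed_space_nvs_image[OF A] isometrically_isomorphic_nvs_image[OF A];
        simp add: h inj_on_subset[OF h_inj])+
  have "banach_space Z"
    by (rule banach_space_isometric[OF Z_iso banach Z])
  moreover have "isometrically_isomorphic (dual_of Z) E"
    using isometrically_isomorphic_sym[OF dual_of_isometric[OF Z_iso A Z] D normed_space_dual_of[OF Z]] E_iso
    by (rule isometrically_isomorphic_trans)
  ultimately have "dual_banach_space E"
    using E_banach by (auto simp: dual_banach_space_def)
  moreover have "finite_dimensional E" if fin: "finite X"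
  proof -
    let ?e = "\<lambda>x y. if y = x then 1 else 0 :: real"
    have sub: "vecs ?A \<subseteq> span (?e ` X)"
    proof
      fix f assume f: "f \<in> vecs ?A"
      have "f y = (\<Sum>x\<in>X. f x *\<^sub>R ?e x) y" for y
        using that Lip0_outside[OF f, of y] unfolding mX
        by (cases "y \<in> X") (simp_all add: sum_fun_eval if_distrib[of "\<lambda>r. _ * r"] cong: if_cong)
      then have "f = (\<Sum>x\<in>X. f x *\<^sub>R ?e x)"
        by (rule ext)
      also have "\<dots> \<in> span (?e ` X)"
        by (intro span_sum span_scale span_base) auto
      finally show "f \<in> span (?e ` X)" .
    qed
    obtain B where B: "independent B" "finite B" "span B = vecs ?A" "card B \<le> card (?e ` X)"
      using subspace_basis_card_le[OF normed_space_subspace[OF A] sub finite_imageI[OF fin]] .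
    obtain C where C: "independent C" "finite C" "span C = vecs (dual_of ?A)" "card C \<le> card B"
      using dual_basis_card_le[OF A B(1-3)] .
    have "vecs E = span (?i ` C)"
      unfolding linear_span_image[OF i] C(3) by (simp add: E_def)
    with C(2) show ?thesis
      by (auto simp: finite_dimensional_def)
  qed
  ultimately show thesis
    using E_iso that by blast
qed


section \<open>Comparison of the extension constants\<close>

theorem theorem1p2:
  fixes Y :: "'a metric"
  shows
    "(\<forall>(X :: 'a set) (\<B> :: 'v::real_vector nvs set).
        X \<noteq> {} \<and> X \<subseteq> mspace Y \<and> (\<forall>E\<in>\<B>. banach_space E) \<longrightarrow>
          nu_class \<B> X Y \<le> K_const TYPE('u::real_vector) \<B> *
            (SUP F\<in>{F. finite F \<and> F \<noteq> {} \<and> F \<subseteq> X}. lambda_Lip F Y) \<and>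
          (\<forall>p\<in>X. (\<exists>E\<in>\<B>. isometrically_isomorphic (dual_of (Lip0 p (submetric Y X))) E) \<longrightarrow>
            lambda_Lip X Y \<le> nu_class \<B> X Y)) \<and>
     lambda_Lip_all Y = nu_dual TYPE('u) Y \<and>
     nu_dual TYPE('u) Y = nu_fin TYPE('u) Y"
proof -
  have bidual: "nu_class \<B> X Y \<le> K_const TYPE('u) \<B> * (SUP F\<in>{F. finite F \<and> F \<noteq> {} \<and> F \<subseteq> X}. lambda_Lip F Y)"
    if X: "X \<noteq> {}" "X \<subseteq> mspace Y" and \<B>: "\<forall>E\<in>\<B>. banach_space E" for X and \<B> :: "'v nvs set"
  proof -
    have "nu_class \<B> X Y \<le> K_const TYPE('u) \<B> * lambda_Lip X Y"
      unfolding nu_class_def using \<B> ext_const_le_K_const_mult_lambda_Lip[OF _ _ X(2,1)]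
      by (intro SUP_least) auto
    also have "\<dots> \<le> K_const TYPE('u) \<B> * (SUP F\<in>{F. finite F \<and> F \<noteq> {} \<and> F \<subseteq> X}. lambda_Lip F Y)"
      using lambda_Lip_le_SUP_finite[OF X(2,1)] by (rule mult_left_mono) simp
    finally show ?thesis .
  qed
  have evaluation: "lambda_Lip X Y \<le> nu_class \<B> X Y"
    if "X \<subseteq> mspace Y" "\<forall>E\<in>\<B>. banach_space E" "p \<in> X"
      "\<exists>E\<in>\<B>. isometrically_isomorphic (dual_of (Lip0 p (submetric Y X))) E" for X p and \<B> :: "'v nvs set"
    using that lambda_Lip_le_nu_class normed_space_if_banach_space by metis
  let ?U = "{X. X \<noteq> {} \<and> X \<subseteq> mspace Y}"
  have dual_le: "nu_dual TYPE('u) Y \<le> lambda_Lip_all Y"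
    unfolding nu_dual_def nu_class_all_def lambda_Lip_all_def
  proof (rule SUP_mono, rule bexI)
    fix X assume "X \<in> ?U"
    then show "nu_class {E :: ('a, 'u) banach_universe nvs. dual_banach_space E} X Y \<le> lambda_Lip X Y"
      unfolding nu_class_def by (intro SUP_least) (auto intro: ext_const_le_lambda_Lip_if_dual)
  qed
  have fin_le: "nu_fin TYPE('u) Y \<le> nu_dual TYPE('u) Y"
    unfolding nu_fin_def nu_dual_def nu_class_all_def nu_class_def
    by (intro SUP_subset_mono) (auto intro: dual_banach_space_if_finite_dimensional)
  have finite_le: "lambda_Lip F Y \<le> nu_fin TYPE('u) Y" if F: "finite F" "F \<noteq> {}" "F \<subseteq> mspace Y" for F
  proof -
    obtain p where p: "p \<in> F"
      using F(2) by auto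
    obtain E :: "('a, 'u) banach_universe nvs" where E: "dual_banach_space E"
      "isometrically_isomorphic (dual_of (Lip0 p (submetric Y F))) E" "finite_dimensional E"
      using copy_of_dual_Lip0[OF F(3) p] F(1) by metis
    then have "banach_space E"
      by (simp add: dual_banach_space_def)
    then have "lambda_Lip F Y \<le> nu_class {E :: ('a, 'u) banach_universe nvs. banach_space E \<and> finite_dimensional E} F Y"
      using E by (intro lambda_Lip_le_nu_class[OF F(3) p _ _ E(2)]) (auto intro: normed_space_if_banach_space)
    also have "\<dots> \<le> nu_fin TYPE('u) Y"
      unfolding nu_fin_def nu_class_all_def using F by (intro SUP_upper) auto
    finally show ?thesis .
  qed
  have le_fin: "lambda_Lip_all Y \<le> nu_fin TYPE('u) Y"
    unfolding lambda_Lip_all_def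
  proof (rule SUP_least)
    fix X assume "X \<in> ?U"
    then have X: "X \<subseteq> mspace Y" "X \<noteq> {}"
      by auto
    have "lambda_Lip X Y \<le> (SUP F\<in>{F. finite F \<and> F \<noteq> {} \<and> F \<subseteq> X}. lambda_Lip F Y)"
      by (rule lambda_Lip_le_SUP_finite[OF X])
    also have "\<dots> \<le> nu_fin TYPE('u) Y"
      using X(1) by (intro SUP_least finite_le) auto
    finally show "lambda_Lip X Y \<le> nu_fin TYPE('u) Y" .
  qed
  show ?thesis
  proof (intro conjI allI impI ballI; (elim conjE)?)
    show "lambda_Lip_all Y = nu_dual TYPE('u) Y" "nu_dual TYPE('u) Y = nu_fin TYPE('u) Y"
      using dual_le fin_le le_fin by auto
  qed (rule bidual evaluation; assumption)+
qed

end
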